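(* Let $\mathcal{T}=(\mathcal{F},\mathcal{E},\mathcal{V})$ be a triangulation in $\mathbb{R}^3$ with associated $2$-varifold $V_{\mathcal{T}}$. Let $x\in\mathcal{V}$ be a vertex and let $\widehat{\varphi_x}:\mathbb{R}^3\to\mathbb{R}_+$ be a Lipschitz extension of the nodal function $\varphi_x$. Then \[ \delta V_{\mathcal{T}}(\widehat{\varphi_x})=-\langle\widehat{H},\varphi_x\rangle=-\frac12\sum_{v\in\mathcal{V}(x)}\left(\cot\alpha_{xv}+\cot\beta_{xv}\right)(v-x). \]
   Context: A triangulation $\mathcal{T}=(\mathcal{F},\mathcal{E},\mathcal{V})$ in $\mathbb{R}^3$ consists of a set of vertices $\mathcal{V}\subset\mathbb{R}^3$, edges $\mathcal{E}\subset\mathcal{V}\times\mathcal{V}$ and (non-degenerate) triangular faces $\mathcal{F}$ forming a polyhedral surface $M_{\mathcal{T}}=\bigcup_{F\in\mathcal{F}}F$ homeomorphic to a $2$-manifold (without boundary, so that every edge is shared by exactly two triangles). For $v\in\mathcal{V}$, the nodal function $\varphi_v:M_{\mathcal{T}}\to\mathbb{R}$ is the function that is affine on each face, with $\varphi_v(v)=1$ and $\varphi_v(w)=0$ for every $w\in\mathcal{V}$, $w\ne v$. For a vertex $x$, $\mathcal{V}(x)$ is the set of vertices connected to $x$ by an edge; for $v\in\mathcal{V}(x)$, $\alpha_{xv}$ and $\beta_{xv}$ are the two angles opposite to the edge $(xv)$ in the two triangles sharing that edge. The vector-valued functional $\widehat{H}$ is defined on nodal functions by the Cotangent Formula \[ \langle\widehat{H},\varphi_x\rangle=\frac12\sum_{v\in\mathcal{V}(x)}(\cot\alpha_{xv}+\cot\beta_{xv})(v-x).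 \] The varifold associated with $\mathcal{T}$ is the measure $V_{\mathcal{T}}=\sum_{F\in\mathcal{F}}\mathcal{H}^2_{|F}\otimes\delta_{P_F}$ on $\mathbb{R}^3\times G_{2,3}$, where $P_F$ is the linear plane direction of $F$ and $G_{2,3}$ is the Grassmannian of $2$-planes in $\mathbb{R}^3$. For a vector field $X$, $\delta V(X)=\int\mathrm{div}_PX(y)\,dV(y,P)$ with $\mathrm{div}_PX=\sum_j\langle\Pi_P(\nabla X_j),e_j\rangle$, where $\Pi_P$ is the orthogonal projection onto $P$; for a scalar function $g$, $\delta V(g)=(\delta V(g\,e_1),\delta V(g\,e_2),\delta V(g\,e_3))$. Thus for a Lipschitz function $g$ on $\mathbb{R}^3$, \[ \delta V_{\mathcal{T}}(g)=\sum_{F\in\mathcal{F}}\int_F\nabla^{P_F}g(y)\,d\mathcal{H}^2(y)\in\mathbb{R}^3, \] where $\nabla^{P_F}g$ is the tangential gradient along the face $F$ (the gradient of $g|_F$, defined $\mathcal{H}^2$-a.e. on $F$). *)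

theory Defs
  imports "HOL-Analysis.Analysis" "HOL-Probability.Giry_Monad"
begin

section \<open>Triangulated surfaces\<close>

definition polyhedral_surface :: "(real^3) set set \<Rightarrow> (real^3) set" where
  "polyhedral_surface \<F> = \<Union>\<F>"

definition face_vertices :: "(real^3) set \<Rightarrow> (real^3) set" where
  "face_vertices F = {v. v extreme_point_of F}"

text \<open>Faces through the edge \<open>(v, w)\<close>.\<close>
definition edge_faces :: "(real^3) set set \<Rightarrow> real^3 \<Rightarrow> real^3 \<Rightarrow> (real^3) set set" where
  "edge_faces \<F> v w = {F \<in> \<F>. v \<in> face_vertices F \<and> w \<in> face_vertices F}"

text \<open>Every point has a relatively open neighbourhood homeomorphic to an open subset of the plane.
  The Hausdorff and second-countability axioms hold in any subspace of Euclidean space.\<close>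
definition surface_without_boundary :: "(real^3) set \<Rightarrow> bool" where
  "surface_without_boundary M \<longleftrightarrow>
     (\<forall>y\<in>M. \<exists>U (W :: (real^2) set). openin (top_of_set M) U \<and> y \<in> U \<and> open W \<and> U homeomorphic W)"

text \<open>An unoriented edge is represented by both of its ordered pairs. The family of faces may be
  infinite, but it is locally finite; two faces meet in a common face (empty, a vertex, an edge).\<close>
definition surface_triangulation ::
  "(real^3) set set \<Rightarrow> ((real^3) \<times> (real^3)) set \<Rightarrow> (real^3) set \<Rightarrow> bool" where
  "surface_triangulation \<F> \<E> \<V> \<longleftrightarrow>
     (\<forall>F\<in>\<F>. 2 simplex F) \<and>
     \<V> = (\<Union>F\<in>\<F>. face_vertices F) \<and>
     \<E> = {(v, w). v \<noteq> w \<and> edge_faces \<F> v w \<noteq> {}} \<and>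
     (\<forall>F\<in>\<F>. \<forall>G\<in>\<F>. (F \<inter> G) face_of F) \<and>
     (\<forall>y\<in>polyhedral_surface \<F>. \<exists>r>0. finite {F \<in> \<F>. F \<inter> ball y r \<noteq> {}}) \<and>
     surface_without_boundary (polyhedral_surface \<F>) \<and>
     (\<forall>(v, w)\<in>\<E>. card (edge_faces \<F> v w) = 2)"

definition neighbours :: "((real^3) \<times> (real^3)) set \<Rightarrow> real^3 \<Rightarrow> (real^3) set" where
  "neighbours \<E> x = {v. (x, v) \<in> \<E>}"

text \<open>Only the values of \<open>\<phi>\<close> on the polyhedral surface matter.\<close>
definition nodal_function ::
  "(real^3) set set \<Rightarrow> (real^3) set \<Rightarrow> real^3 \<Rightarrow> (real^3 \<Rightarrow> real) \<Rightarrow> bool" where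
  "nodal_function \<F> \<V> v \<phi> \<longleftrightarrow>
     (\<forall>F\<in>\<F>. \<exists>a b. \<forall>y\<in>F. \<phi> y = a \<bullet> y + b) \<and>
     \<phi> v = 1 \<and> (\<forall>w\<in>\<V>. w \<noteq> v \<longrightarrow> \<phi> w = 0)"

section \<open>The Cotangent Formula\<close>

definition angle_at :: "real^3 \<Rightarrow> real^3 \<Rightarrow> real^3 \<Rightarrow> real" where
  "angle_at p w q = arccos (((p - w) \<bullet> (q - w)) / (norm (p - w) * norm (q - w)))"

definition opposite_angle :: "(real^3) set \<Rightarrow> real^3 \<Rightarrow> real^3 \<Rightarrow> real" where
  "opposite_angle F x v = angle_at x (THE w. w \<in> face_vertices F \<and> w \<noteq> x \<and> w \<noteq> v) v"

definition edge_opposite_angles ::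
  "(real^3) set set \<Rightarrow> real^3 \<Rightarrow> real^3 \<Rightarrow> real \<Rightarrow> real \<Rightarrow> bool" where
  "edge_opposite_angles \<F> x v \<alpha> \<beta> \<longleftrightarrow>
     (\<exists>F G. F \<noteq> G \<and> edge_faces \<F> x v = {F, G} \<and>
        \<alpha> = opposite_angle F x v \<and> \<beta> = opposite_angle G x v)"

text \<open>The functional takes a nodal function and recovers its vertex. For an edge \<open>(x, v)\<close> the inner
  sum has exactly two terms, one for each triangle sharing the edge: it is
  \<open>cot \<alpha>\<^sub>x\<^sub>v + cot \<beta>\<^sub>x\<^sub>v\<close>.\<close>
definition cotangent_curvature ::
  "(real^3) set set \<Rightarrow> ((real^3) \<times> (real^3)) set \<Rightarrow> (real^3) set \<Rightarrow> (real^3 \<Rightarrow> real) \<Rightarrow> real^3" where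
  "cotangent_curvature \<F> \<E> \<V> \<phi> =
     (let x = (THE x. x \<in> \<V> \<and> nodal_function \<F> \<V> x \<phi>) in
      (1/2) *\<^sub>R (\<Sum>v\<in>neighbours \<E> x.
         (\<Sum>F\<in>edge_faces \<F> x v. cot (opposite_angle F x v)) *\<^sub>R (v - x)))"

section \<open>Two-dimensional Hausdorff measure\<close>

text \<open>Normalised by the area of the unit disc. Boundedness is required separately because
  \<^const>\<open>diameter\<close> is \<open>0\<close> on unbounded sets.\<close>
definition hausdorff2_pre :: "real \<Rightarrow> 'a::metric_space set \<Rightarrow> ennreal" where
  "hausdorff2_pre \<delta> A =
     (INF C\<in>{C :: nat \<Rightarrow> 'a set. A \<subseteq> (\<Union>i. C i) \<and> (\<forall>i. bounded (C i) \<and> diameter (C i) \<le> \<delta>)}.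
        \<Sum>i. ennreal (pi * (diameter (C i) / 2)\<^sup>2))"

definition hausdorff2_outer :: "'a::metric_space set \<Rightarrow> ennreal" where
  "hausdorff2_outer A = (SUP \<delta>\<in>{0<..}. hausdorff2_pre \<delta> A)"

text \<open>The outer measure is a metric outer measure, hence countably additive on the Borel sets
  (Caratheodory's criterion), so that \<^const>\<open>measure_of\<close> does assign it to every Borel set.\<close>
definition hausdorff2 :: "'a::metric_space measure" where
  "hausdorff2 = measure_of UNIV (sets borel) hausdorff2_outer"

section \<open>Varifolds and first variation\<close>

definition plane_proj :: "(real^3) set \<Rightarrow> real^3 \<Rightarrow> real^3" where
  "plane_proj P y = (THE p. p \<in> P \<and> (\<forall>q\<in>P. (y - p) \<bullet> q = 0))"

text \<open>The Grassmannian of 2-planes with its Borel structure, that is, with the one induced by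
  identifying a plane with the matrix of the orthogonal projection onto it.\<close>
definition grassmannian :: "(real^3) set measure" where
  "grassmannian = vimage_algebra {P. subspace P \<and> dim P = 2} (\<lambda>P. matrix (plane_proj P)) borel"

definition face_direction :: "(real^3) set \<Rightarrow> (real^3) set" where
  "face_direction F = span {y - z | y z. y \<in> F \<and> z \<in> F}"

text \<open>The restriction of the Hausdorff measure to \<open>F\<close> is its \<^const>\<open>density\<close> with respect to the
  indicator of \<open>F\<close>; the sum over the faces is an integral against counting measure.\<close>
definition face_varifold :: "(real^3) set \<Rightarrow> ((real^3) \<times> (real^3) set) measure" where
  "face_varifold F =
     density hausdorff2 (indicator F) \<Otimes>\<^sub>M return grassmannian (face_direction F)"

definition surface_varifold :: "(real^3) set set \<Rightarrow> ((real^3) \<times> (real^3) set) measure" where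
  "surface_varifold \<F> =
     measure_of (space (borel \<Otimes>\<^sub>M grassmannian)) (sets (borel \<Otimes>\<^sub>M grassmannian))
       (\<lambda>B. \<integral>\<^sup>+ F. emeasure (face_varifold F) B \<partial>count_space \<F>)"

text \<open>The tangential gradient at \<open>y\<close> along the linear plane \<open>P\<close> is the gradient of the restriction of
  \<open>g\<close> to the affine plane \<open>y + P\<close>. It needs no differentiability of \<open>g\<close> in the ambient space, hence
  applies to Lipschitz functions; in the relative interior of a face \<open>F\<close> of direction \<open>P\<close> it is the
  gradient of \<open>g\<close> restricted to \<open>F\<close>. The value where the restriction is not differentiable is
  unspecified. Where \<open>g\<close> is differentiable, it is the projection of the full gradient onto \<open>P\<close>, by
  \<open>tangential_gradient_eq_proj\<close>.\<close>
definition tangential_gradient :: "(real^3) set \<Rightarrow> (real^3 \<Rightarrow> real) \<Rightarrow> real^3 \<Rightarrow> real^3" where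
  "tangential_gradient P g y =
     (THE t. t \<in> P \<and> (g has_derivative (\<lambda>h. t \<bullet> h)) (at y within (+) y ` P))"

definition tangential_divergence :: "(real^3) set \<Rightarrow> (real^3 \<Rightarrow> real^3) \<Rightarrow> real^3 \<Rightarrow> real" where
  "tangential_divergence P X y =
     (\<Sum>j\<in>UNIV. tangential_gradient P (\<lambda>z. X z $ j) y \<bullet> axis j 1)"

text \<open>The integral is taken against the completion, since the divergence of a Lipschitz field is only
  determined almost everywhere.\<close>
definition first_variation ::
  "((real^3) \<times> (real^3) set) measure \<Rightarrow> (real^3 \<Rightarrow> real^3) \<Rightarrow> real" where
  "first_variation V X = (\<integral>(y, P). tangential_divergence P X y \<partial>completion V)"

definition first_variation_scalar ::
  "((real^3) \<times> (real^3) set) measure \<Rightarrow> (real^3 \<Rightarrow> real) \<Rightarrow> real^3" where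
  "first_variation_scalar V g = (\<chi> j. first_variation V (\<lambda>y. g y *\<^sub>R axis j 1))"

lemma plane_proj_props:
  assumes "subspace P"
  shows "plane_proj P y \<in> P" and "\<And>q. q \<in> P \<Longrightarrow> (y - plane_proj P y) \<bullet> q = 0"
proof -
  obtain p z where p: "p \<in> span P" and z: "\<And>w. w \<in> span P \<Longrightarrow> orthogonal z w" and yz: "y = p + z"
    using orthogonal_subspace_decomp_exists[of P y] by metis
  have ex: "p \<in> P \<and> (\<forall>q\<in>P. (y - p) \<bullet> q = 0)"
    using p z yz assms by (auto simp: span_eq_iff[THEN iffD2] orthogonal_def)
  have "p' = p" if "p' \<in> P \<and> (\<forall>q\<in>P. (y - p') \<bullet> q = 0)" for p'
  proof -
    have "p - p' \<in> P" using that ex assms by (simp add: subspace_diff)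
    then have "(y - p') \<bullet> (p - p') = 0" "(y - p) \<bullet> (p - p') = 0" using that ex by auto
    then have "(p - p') \<bullet> (p - p') = 0" by (simp add: inner_diff_left)
    then show ?thesis by simp
  qed
  then have "plane_proj P y \<in> P \<and> (\<forall>q\<in>P. (y - plane_proj P y) \<bullet> q = 0)"
    unfolding plane_proj_def
    by (rule theI[where P = "\<lambda>p. p \<in> P \<and> (\<forall>q\<in>P. (y - p) \<bullet> q = 0)", OF ex])
  then show "plane_proj P y \<in> P" "\<And>q. q \<in> P \<Longrightarrow> (y - plane_proj P y) \<bullet> q = 0" by auto
qed

lemma tangential_gradient_unique:
  assumes P: "subspace P"
    and t: "t \<in> P" "(g has_derivative (\<lambda>h. t \<bullet> h)) (at y within (+) y ` P)"
  shows "tangential_gradient P g y = t"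
  unfolding tangential_gradient_def
proof (rule the_equality)
  fix s assume s: "s \<in> P \<and> (g has_derivative (\<lambda>h. s \<bullet> h)) (at y within (+) y ` P)"
  define u where "u = s - t"
  have u: "u \<in> P" using s t P by (simp add: u_def subspace_diff)
  let ?l = "\<lambda>r::real. y + r *\<^sub>R u"
  have l: "(?l has_derivative (\<lambda>r. r *\<^sub>R u)) (at 0)"
    by (auto intro!: derivative_eq_intros)
  have im: "range ?l \<subseteq> (+) y ` P" using u P by (auto simp: subspace_scale)
  have "((g \<circ> ?l) has_derivative (\<lambda>h. d \<bullet> h) \<circ> (\<lambda>r. r *\<^sub>R u)) (at 0)"
    if "(g has_derivative (\<lambda>h. d \<bullet> h)) (at y within (+) y ` P)" for d
    using diff_chain_within[OF l, of g "\<lambda>h. d \<bullet> h"] has_derivative_subset[OF that im] by simp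
  then have "(\<lambda>h. s \<bullet> h) \<circ> (\<lambda>r. r *\<^sub>R u) = (\<lambda>h. t \<bullet> h) \<circ> (\<lambda>r::real. r *\<^sub>R u)"
    using s t(2) has_derivative_unique by blast
  from fun_cong[OF this, of 1] have "s \<bullet> u = t \<bullet> u" by simp
  then have "u \<bullet> u = 0" by (simp add: u_def inner_diff_left)
  then show "s = t" by (simp add: u_def)
qed (use t in blast)

lemma tangential_gradient_eq_proj:
  assumes P: "subspace P" and D: "(g has_derivative (\<lambda>h. D \<bullet> h)) (at y)"
  shows "tangential_gradient P g y = plane_proj P D"
proof (rule tangential_gradient_unique[OF P plane_proj_props(1)[OF P]])
  let ?D = "plane_proj P D"
  have "((\<lambda>z. g z - (D - ?D) \<bullet> (z - y)) has_derivative (\<lambda>h. ?D \<bullet> h)) (at y within (+) y ` P)"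
    by (rule derivative_eq_intros has_derivative_at_withinI[OF D] refl)+
       (simp add: inner_diff_left)
  then show "(g has_derivative (\<lambda>h. ?D \<bullet> h)) (at y within (+) y ` P)"
  proof (rule has_derivative_transform[rotated 2])
    show "y \<in> (+) y ` P" using subspace_0[OF P] by force
    show "g z = g z - (D - ?D) \<bullet> (z - y)" if "z \<in> (+) y ` P" for z
      using that plane_proj_props(2)[OF P, of _ D] by auto
  qed
qed

end

theory Submission
  imports Defs
begin

text \<open>Along a face the nodal function is affine, so the first variation is the finite sum, over the
  faces at \<open>x\<close>, of area times constant gradient; on the triangle \<open>x v w\<close> with \<open>p = v - x\<close> and
  \<open>q = w - x\<close> the gradient is the vector of the plane having inner product \<open>-1\<close> with \<open>p\<close> and \<open>q\<close>, and
  multiplied by the area it is \<open>-1/2\<close> times the sum of \<open>p\<close> and \<open>q\<close> weighted by the cotangents of the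
  opposite angles. Regrouping by edges gives the Cotangent Formula.

  The area here is a Hausdorff measure. It is a metric outer measure, hence a Borel measure
  by Caratheodory's criterion, and it is invariant under isometric embeddings. In the plane it
  equals Lebesgue measure: Vitali coverings by discs give one inequality, and the isodiametric
  inequality, proved by two Steiner symmetrisations, the other.\<close>

section \<open>Hausdorff measure as a Borel measure\<close>

text \<open>Two obstacles shape the proof. A Lipschitz extension need not be differentiable in space
  at points of the surface; but the tangential gradient sees only the plane of the face, and around
  a relative interior point the extension is affine in that plane. Only the edges are lost. They
  must be shown null, and since the integrand is arbitrary there, measurability holds only for the
  completion. Moreover the triangulation may be infinite and the varifold of infinite mass; the
  gradient vanishes off the star of x, which local finiteness makes finite, so the integral is that
  of a simple function. The Hausdorff premeasure weighs a set by the area of a disc of the same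
  diameter. The isodiametric inequality says that no set of that diameter has larger area, so the
  comparison with Lebesgue measure holds with constant 1. All cotangents come from one number, the
  Gram determinant G of two edge vectors: the area is sqrt G / 2, the gradient has denominator G and
  each cotangent has denominator sqrt G.\<close>

lemma hausdorff2_pre_le:
  assumes "A \<subseteq> (\<Union>i. C i)" "\<And>i. bounded (C i)" "\<And>i. diameter (C i) \<le> \<delta>"
  shows "hausdorff2_pre \<delta> A \<le> (\<Sum>i. ennreal (pi * (diameter (C i) / 2)\<^sup>2))"
  unfolding hausdorff2_pre_def using assms by (intro INF_lower) auto

lemma hausdorff2_pre_close:
  assumes "hausdorff2_pre \<delta> A < e"
  obtains C where "A \<subseteq> (\<Union>i. C i)" "\<And>i. bounded (C i)" "\<And>i. diameter (C i) \<le> \<delta>"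
    "(\<Sum>i. ennreal (pi * (diameter (C i) / 2)\<^sup>2)) < e"
  using assms unfolding hausdorff2_pre_def INF_less_iff by blast

lemma hausdorff2_pre_mono: "A \<subseteq> B \<Longrightarrow> hausdorff2_pre \<delta> A \<le> hausdorff2_pre \<delta> B"
  unfolding hausdorff2_pre_def by (rule INF_superset_mono) auto

lemma hausdorff2_pre_antimono: "\<delta> \<le> \<delta>' \<Longrightarrow> hausdorff2_pre \<delta>' A \<le> hausdorff2_pre \<delta> A"
  unfolding hausdorff2_pre_def by (rule INF_superset_mono) (auto intro: order_trans)

text \<open>For negative \<delta> no cover is admissible, since diameters are nonnegative, and the
  infimum over the empty family is \<open>top\<close>; hence the sign condition.\<close>

lemma hausdorff2_pre_empty: "0 \<le> \<delta> \<Longrightarrow> hausdorff2_pre \<delta> {} = 0"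
  using hausdorff2_pre_le[of "{}" "\<lambda>_. {}" \<delta>] by simp

lemma hausdorff2_pre_UN:
  "hausdorff2_pre \<delta> (\<Union>n::nat. A n) \<le> (\<Sum>n. hausdorff2_pre \<delta> (A n))"
proof (rule ennreal_le_epsilon)
  let ?O = "hausdorff2_pre \<delta>"
  let ?f = "\<lambda>C::'a set. ennreal (pi * (diameter C / 2)\<^sup>2)"
  fix e :: real assume "0 < e" "(\<Sum>n. ?O (A n)) < top"
  then have *: "\<And>n. ?O (A n) < ?O (A n) + e * (1/2)^Suc n"
    by (auto simp add: less_top dest!: ennreal_suminf_lessD)
  have "\<exists>C. A n \<subseteq> (\<Union>i. C i) \<and> (\<forall>i. bounded (C i) \<and> diameter (C i) \<le> \<delta>) \<and>
    (\<Sum>i. ?f (C i)) \<le> ?O (A n) + e * (1/2)^Suc n" for n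
    by (rule hausdorff2_pre_close[OF *[of n]]) (metis less_imp_le)
  then obtain B where B: "\<And>n. A n \<subseteq> (\<Union>i. B n i)"
      "\<And>n i. bounded (B n i)" "\<And>n i. diameter (B n i) \<le> \<delta>"
      "\<And>n. (\<Sum>i. ?f (B n i)) \<le> ?O (A n) + e * (1/2)^Suc n"
    by metis
  \<comment> \<open>The double family of covers, each optimal up to e/2^(n+1), is listed as one
    sequence by the pairing bijection.\<close>
  define C where "C = case_prod B o prod_decode"
  have sub: "(\<Union>n. A n) \<subseteq> (\<Union>i. C i)"
    using B(1) by (auto simp add: C_def subset_eq) (metis prod.case prod_encode_inverse)
  have "?O (\<Union>n. A n) \<le> (\<Sum>i. ?f (C i))"
    using sub by (rule hausdorff2_pre_le) (auto simp: C_def split_def B)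
  also have "\<dots> = (\<Sum>n. \<Sum>i. ?f (B n i))"
    unfolding C_def comp_def by (rule suminf_ennreal_2dimen) auto
  also have "\<dots> \<le> (\<Sum>n. ?O (A n) + e * (1/2) ^ Suc n)"
    by (intro suminf_le B(4) allI) auto
  also have "... = (\<Sum>n. ?O (A n)) + (\<Sum>n. ennreal e * ennreal ((1/2) ^ Suc n))"
    using \<open>0 < e\<close> by (subst suminf_add[symmetric])
      (auto simp del: ennreal_suminf_cmult simp add: ennreal_mult[symmetric])
  also have "\<dots> = (\<Sum>n. ?O (A n)) + e"
    unfolding ennreal_suminf_cmult
    by (subst suminf_ennreal_eq[OF zero_le_power power_half_series]) auto
  finally show "?O (\<Union>n. A n) \<le> (\<Sum>n. ?O (A n)) + e" .
qed

section \<open>Passage from a fixed scale to the outer measure\<close>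

lemma hausdorff2_pre_le_outer: "0 < \<delta> \<Longrightarrow> hausdorff2_pre \<delta> A \<le> hausdorff2_outer A"
  unfolding hausdorff2_outer_def by (rule SUP_upper) simp

lemma hausdorff2_outer_leI:
  "(\<And>\<delta>. 0 < \<delta> \<Longrightarrow> hausdorff2_pre \<delta> A \<le> c) \<Longrightarrow> hausdorff2_outer A \<le> c"
  unfolding hausdorff2_outer_def by (rule SUP_least) simp

lemma hausdorff2_outer_mono: "A \<subseteq> B \<Longrightarrow> hausdorff2_outer A \<le> hausdorff2_outer B"
  unfolding hausdorff2_outer_def by (rule SUP_mono) (auto intro: hausdorff2_pre_mono)

lemma hausdorff2_outer_empty [simp]: "hausdorff2_outer {} = 0"
proof -
  have "hausdorff2_outer ({} :: 'a set) \<le> 0"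
    by (rule hausdorff2_outer_leI) (simp add: hausdorff2_pre_empty)
  then show ?thesis by simp
qed

lemma hausdorff2_outer_UN:
  "hausdorff2_outer (\<Union>n::nat. A n) \<le> (\<Sum>n. hausdorff2_outer (A n))"
proof (rule hausdorff2_outer_leI)
  fix \<delta> :: real assume "0 < \<delta>"
  have "hausdorff2_pre \<delta> (\<Union>n::nat. A n) \<le> (\<Sum>n. hausdorff2_pre \<delta> (A n))"
    by (rule hausdorff2_pre_UN)
  also have "\<dots> \<le> (\<Sum>n. hausdorff2_outer (A n))"
    by (intro suminf_le allI hausdorff2_pre_le_outer \<open>0 < \<delta>\<close>) auto
  finally show "hausdorff2_pre \<delta> (\<Union>n::nat. A n) \<le> (\<Sum>n. hausdorff2_outer (A n))" .
qed

lemma hausdorff2_outer_Un: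
  "hausdorff2_outer (A \<union> B) \<le> hausdorff2_outer A + hausdorff2_outer B"
proof -
  have "hausdorff2_outer (\<Union>n. binaryset A B n) \<le> (\<Sum>n. hausdorff2_outer (binaryset A B n))"
    by (rule hausdorff2_outer_UN)
  also have "\<dots> = hausdorff2_outer A + hausdorff2_outer B"
    by (rule suminf_binaryset_eq) simp
  finally show ?thesis by (simp add: UN_binaryset_eq)
qed

lemma hausdorff2_outer_space: "outer_measure_space UNIV hausdorff2_outer"
  unfolding outer_measure_space_def positive_def increasing_def countably_subadditive_def
  by (auto intro: hausdorff2_outer_mono hausdorff2_outer_UN)

text \<open>A covering set of diameter at most \<delta> cannot meet both A and B, so intersecting a
  cover with A and with B splits its sum into two parts.\<close>

lemma hausdorff2_pre_separated:
  assumes sep: "\<And>a b. a \<in> A \<Longrightarrow> b \<in> B \<Longrightarrow> \<delta> < dist a b" and "0 \<le> \<delta>"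
  shows "hausdorff2_pre \<delta> A + hausdorff2_pre \<delta> B \<le> hausdorff2_pre \<delta> (A \<union> B)"
proof -
  let ?f = "\<lambda>C::'a set. ennreal (pi * (diameter C / 2)\<^sup>2)"
  have "hausdorff2_pre \<delta> A + hausdorff2_pre \<delta> B \<le> (\<Sum>i. ?f (C i))"
    if C: "A \<union> B \<subseteq> (\<Union>i. C i)" "\<And>i. bounded (C i)" "\<And>i. diameter (C i) \<le> \<delta>"
    for C :: "nat \<Rightarrow> 'a set"
  proof -
    have d: "diameter (C i \<inter> D) \<le> diameter (C i)" "bounded (C i \<inter> D)" for i D
      using C(2)[of i] by (auto intro: diameter_subset bounded_subset)
    have "hausdorff2_pre \<delta> A + hausdorff2_pre \<delta> B \<le> (\<Sum>i. ?f (C i \<inter> A)) + (\<Sum>i. ?f (C i \<inter> B))"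
    proof (intro add_mono hausdorff2_pre_le)
      show "diameter (C i \<inter> A) \<le> \<delta>" "diameter (C i \<inter> B) \<le> \<delta>" for i
        using d(1) C(3) order_trans by blast+
    qed (use C d in auto)
    also have "\<dots> = (\<Sum>i. ?f (C i \<inter> A) + ?f (C i \<inter> B))"
      by (rule suminf_add) auto
    also have "\<dots> \<le> (\<Sum>i. ?f (C i))"
    proof (intro suminf_le allI)
      fix i
      have "C i \<inter> A = {} \<or> C i \<inter> B = {}"
      proof (rule ccontr)
        assume "\<not> ?thesis"
        then obtain a b where ab: "a \<in> C i" "a \<in> A" "b \<in> C i" "b \<in> B" by auto
        then have "dist a b \<le> \<delta>"
          using diameter_bounded_bound[OF C(2)] C(3) order_trans by blast
        then show False using sep ab by fastforce
      qed
      moreover have "?f (C i \<inter> D) \<le> ?f (C i)" for D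
        using d[where i=i and D=D] diameter_ge_0[OF d(2)]
        by (intro ennreal_leI mult_left_mono power_mono) (auto simp: divide_right_mono)
      ultimately show "?f (C i \<inter> A) + ?f (C i \<inter> B) \<le> ?f (C i)" by auto
    qed auto
    finally show ?thesis .
  qed
  then show ?thesis
    unfolding hausdorff2_pre_def[of _ "A \<union> B"] by (intro INF_greatest) auto
qed

lemma hausdorff2_outer_separated:
  assumes sep: "\<And>a b. a \<in> A \<Longrightarrow> b \<in> B \<Longrightarrow> r \<le> dist a b" and r: "0 < r"
  shows "hausdorff2_outer (A \<union> B) = hausdorff2_outer A + hausdorff2_outer B"
proof (rule antisym[OF hausdorff2_outer_Un])
  have *: "hausdorff2_pre \<delta> A + hausdorff2_pre \<delta>' B \<le> hausdorff2_outer (A \<union> B)"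
    if "0 < \<delta>" "0 < \<delta>'" for \<delta> \<delta>'
  proof -
    \<comment> \<open>Finer than both given scales, and strictly below the separation r as the lemma
      at a fixed scale requires.\<close>
    define \<rho> where "\<rho> = min (min \<delta> \<delta>') (r / 2)"
    have \<rho>: "0 < \<rho>" "\<rho> \<le> \<delta>" "\<rho> \<le> \<delta>'" "\<rho> < r"
      using that r by (auto simp: \<rho>_def min_def)
    have "hausdorff2_pre \<delta> A + hausdorff2_pre \<delta>' B \<le> hausdorff2_pre \<rho> A + hausdorff2_pre \<rho> B"
      using \<rho> by (intro add_mono hausdorff2_pre_antimono)
    also have "\<dots> \<le> hausdorff2_pre \<rho> (A \<union> B)"
      using \<rho> sep by (intro hausdorff2_pre_separated) (auto intro: less_le_trans)
    also have "\<dots> \<le> hausdorff2_outer (A \<union> B)"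
      using \<rho> by (intro hausdorff2_pre_le_outer)
    finally show ?thesis .
  qed
  \<comment> \<open>The scales on the two sides are independent in \<open>*\<close>, so the two
    suprema can be taken one after the other.\<close>
  have "hausdorff2_pre \<delta> A + hausdorff2_outer B \<le> hausdorff2_outer (A \<union> B)" if "0 < \<delta>" for \<delta>
    unfolding hausdorff2_outer_def[of B]
    using * that by (subst ennreal_SUP_add_right) (auto intro!: SUP_least)
  then show "hausdorff2_outer A + hausdorff2_outer B \<le> hausdorff2_outer (A \<union> B)"
    unfolding hausdorff2_outer_def[of A]
    by (subst ennreal_SUP_add_left[symmetric]) (auto intro!: SUP_least)
qed

text \<open>The shells around \<open>E\<close> of even index are mutually separated, and so are those of odd index;
  hence the measures of all shells have a finite sum, whose tails control the part of \<open>A\<close> close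
  to \<open>E\<close>.\<close>
lemma hausdorff2_outer_closed:
  fixes E :: "'a::metric_space set"
  assumes "closed E"
  shows "hausdorff2_outer (A \<inter> E) + hausdorff2_outer (A - E) \<le> hausdorff2_outer A"
\<comment> \<open>By convention \<open>infdist\<close> is 0 for an empty set, so the shells make
  sense only for nonempty E; finiteness of the measure is needed to cancel in
  \<open>ennreal\<close>.\<close>
proof (cases "E = {} \<or> hausdorff2_outer A = \<infinity>")
  case True
  then show ?thesis by auto
next
  case False
  let ?H = "hausdorff2_outer :: 'a set \<Rightarrow> ennreal"
  define u where "u n = 1 / real (Suc n)" for n
  have u: "0 < u n" "u (Suc n) < u n" for n
    by (auto simp: u_def field_simps)
  have u_mono: "u n \<le> u m" if "m \<le> n" for m n
    using that by (auto simp: u_def field_simps)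
  define R where "R n = {y \<in> A. u (Suc n) \<le> infdist y E \<and> infdist y E < u n}" for n
  define T where "T n = {y \<in> A. u n \<le> infdist y E}" for n
  have dist_ge: "d - d' \<le> dist a b" if "d \<le> infdist a E" "infdist b E \<le> d'" for a b d d'
    using that infdist_triangle[of a E b] by linarith
  \<comment> \<open>Between two different shells of the same parity lies a full skipped shell; its
    width, \<open>u (Suc (2 * m + j)) - u (Suc (Suc (2 * m + j)))\<close>, is the
    separation.\<close>
  have alternate: "(\<Sum>k<n. ?H (R (2 * k + j))) \<le> ?H A" for n j
  proof -
    have "(\<Sum>k<n. ?H (R (2 * k + j))) = ?H (\<Union>k<n. R (2 * k + j))"
    proof (induction n)
      case (Suc n)
      have "?H ((\<Union>k<n. R (2 * k + j)) \<union> R (2 * n + j)) =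
          ?H (\<Union>k<n. R (2 * k + j)) + ?H (R (2 * n + j))"
      proof (cases n)
        case (Suc m)
        show ?thesis
        proof (rule hausdorff2_outer_separated)
          show "0 < u (Suc (2 * m + j)) - u (Suc (Suc (2 * m + j)))" using u by simp
          fix a b assume "a \<in> (\<Union>k<n. R (2 * k + j))" and b: "b \<in> R (2 * n + j)"
          then obtain k where k: "k \<le> m" "a \<in> R (2 * k + j)"
            using Suc by (auto simp: less_Suc_eq_le)
          have "u (Suc (2 * m + j)) \<le> infdist a E"
            using k u_mono[of "Suc (2 * k + j)" "Suc (2 * m + j)"] by (auto simp: R_def)
          moreover have "infdist b E \<le> u (Suc (Suc (2 * m + j)))"
            using b Suc by (auto simp: R_def)
          ultimately show "u (Suc (2 * m + j)) - u (Suc (Suc (2 * m + j))) \<le> dist a b"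
            by (rule dist_ge)
        qed
      qed simp
      with Suc show ?case by (simp add: lessThan_Suc Un_commute add.commute)
    qed simp
    also have "\<dots> \<le> ?H A" by (rule hausdorff2_outer_mono) (auto simp: R_def)
    finally show ?thesis .
  qed
  have sum_R: "(\<Sum>k. ?H (R k)) \<le> ?H A + ?H A"
  proof (rule suminf_le_const)
    fix n
    have "(\<Sum>k<n. ?H (R k)) \<le> (\<Sum>k<2 * n. ?H (R k))"
      by (rule sum_mono2) auto
    also have "\<dots> = (\<Sum>k<n. ?H (R (2 * k + 0))) + (\<Sum>k<n. ?H (R (2 * k + 1)))"
      by (induction n) (simp_all add: ac_simps)
    also have "\<dots> \<le> ?H A + ?H A" by (intro add_mono alternate)
    finally show "(\<Sum>k<n. ?H (R k)) \<le> ?H A + ?H A" .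
  qed simp
  have le_tail: "?H (A \<inter> E) + ?H (A - E) \<le> ?H A + (\<Sum>k. ?H (R (k + n)))" for n
  proof -
    have "A - E \<subseteq> T n \<union> (\<Union>k. R (k + n))"
    proof
      fix y assume y: "y \<in> A - E"
      then have pos: "0 < infdist y E"
        using False assms infdist_pos_not_in_closed[of E y] by auto
      show "y \<in> T n \<union> (\<Union>k. R (k + n))"
      proof (cases "u n \<le> infdist y E")
        case True
        then show ?thesis using y by (auto simp: T_def)
      next
        case le: False
        obtain m where "u m < infdist y E"
          using reals_Archimedean[OF pos] by (auto simp: u_def inverse_eq_divide)
        then have ex: "\<exists>m. u m \<le> infdist y E" by (auto intro: less_imp_le)
        \<comment> \<open>The first threshold not exceeding the distance of y from E. It comes after
          n, and its predecessor still exceeds the distance, so y lies in the shell with the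
          predecessor's index.\<close>
        define m where "m = (LEAST m. u m \<le> infdist y E)"
        have m: "u m \<le> infdist y E" unfolding m_def by (rule LeastI_ex[OF ex])
        have "n < m" using m le u_mono[of m n] by force
        then obtain k where k: "m = Suc (k + n)"
          by (metis add.commute less_imp_Suc_add)
        have "\<not> u (k + n) \<le> infdist y E"
          using not_less_Least[of "k + n" "\<lambda>m. u m \<le> infdist y E"] k by (simp add: m_def)
        then have "y \<in> R (k + n)" using y m k by (auto simp: R_def)
        then show ?thesis by auto
      qed
    qed
    then have "?H (A - E) \<le> ?H (T n) + ?H (\<Union>k. R (k + n))"
      by (meson hausdorff2_outer_mono hausdorff2_outer_Un order_trans)
    also have "\<dots> \<le> ?H (T n) + (\<Sum>k. ?H (R (k + n)))"
      by (intro add_left_mono hausdorff2_outer_UN)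
    finally have "?H (A \<inter> E) + ?H (A - E) \<le> (?H (A \<inter> E) + ?H (T n)) + (\<Sum>k. ?H (R (k + n)))"
      by (simp add: add.assoc add_left_mono)
    also have "?H (A \<inter> E) + ?H (T n) = ?H ((A \<inter> E) \<union> T n)"
    proof (rule hausdorff2_outer_separated[symmetric])
      fix a b assume "a \<in> A \<inter> E" "b \<in> T n"
      then show "u n \<le> dist a b"
        using dist_ge[of "u n" b a 0] by (auto simp: T_def dist_commute)
    qed (rule u)
    also have "\<dots> \<le> ?H A" by (rule hausdorff2_outer_mono) (auto simp: T_def)
    finally show ?thesis by (simp add: add_right_mono)
  qed
  show ?thesis
  proof (rule ennreal_le_epsilon)
    fix e :: real assume e: "0 < e"
    let ?S = "\<Sum>k. ?H (R k)"
    have fin: "?S < \<infinity>"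
      using sum_R False by (auto simp: less_top[symmetric] top_unique)
    have "(\<lambda>n. \<Sum>k<n. ?H (R k)) \<longlonglongrightarrow> ?S" by (rule summable_LIMSEQ) simp
    then have lim: "(\<lambda>n. (\<Sum>k<n. ?H (R k)) + e) \<longlonglongrightarrow> ?S + e" by (intro tendsto_intros)
    moreover have "?S < ?S + e" using fin e by simp
    ultimately have "eventually (\<lambda>n. ?S < (\<Sum>k<n. ?H (R k)) + e) sequentially"
      by (rule order_tendstoD)
    then obtain n where n: "?S < (\<Sum>k<n. ?H (R k)) + e"
      by (auto simp: eventually_sequentially)
    have "?S = (\<Sum>k<n. ?H (R k)) + (\<Sum>k. ?H (R (k + n)))"
      by (subst suminf_offset[of _ n]) (auto simp: add.commute)
    with n have "(\<Sum>k. ?H (R (k + n))) < e"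
      by (simp add: ennreal_add_left_cancel_less)
    with le_tail[of n] show "?H (A \<inter> E) + ?H (A - E) \<le> ?H A + e"
      by (meson add_left_mono less_imp_le order_trans)
  qed
qed

text \<open>The preceding lemma is Caratheodory's criterion for closed sets. The sets satisfying the
  criterion form a sigma-algebra on which the outer measure is countably additive, and this
  sigma-algebra therefore contains the Borel sets.\<close>

lemma measure_space_hausdorff2: "measure_space UNIV (sets borel) hausdorff2_outer"
proof -
  interpret P: sigma_algebra UNIV "UNIV :: 'a set set" using sigma_algebra_Pow[of UNIV] by simp
  let ?L = "lambda_system UNIV UNIV (hausdorff2_outer :: 'a set \<Rightarrow> ennreal)"
  have L: "measure_space UNIV ?L hausdorff2_outer"
    by (rule P.caratheodory_lemma[OF hausdorff2_outer_space])
  then interpret L: sigma_algebra UNIV ?L by (simp add: measure_space_def)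
  have "E \<in> ?L" if "closed E" for E :: "'a set"
    using hausdorff2_outer_closed[OF that]
    by (auto simp: P.lambda_system_eq Int_Diff_Un intro!: antisym
        intro: order_trans[OF _ hausdorff2_outer_Un])
  then have "sets borel \<subseteq> ?L"
    unfolding borel_eq_closed by (subst sets_measure_of) (auto intro!: L.sigma_sets_subset)
  moreover have "sigma_algebra UNIV (sets (borel :: 'a measure))"
    using sets.sigma_algebra_axioms[of "borel :: 'a measure"] by simp
  ultimately show ?thesis
    using L unfolding measure_space_def countably_additive_def positive_def
    by (meson subset_trans subsetD)
qed

lemma sets_hausdorff2 [simp, measurable_cong]: "sets hausdorff2 = sets borel"
  by (simp add: hausdorff2_def sets.sets_measure_of_eq[of borel, simplified])

lemma space_hausdorff2 [simp]: "space hausdorff2 = UNIV"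
  by (simp add: hausdorff2_def)

text \<open>\<open>measure_of\<close> reproduces the given set function only if it is a measure on
  the given sigma-algebra; countable additivity on Borel sets enters here.\<close>

lemma emeasure_hausdorff2:
  "A \<in> sets borel \<Longrightarrow> emeasure hausdorff2 A = hausdorff2_outer A"
  using measure_space_hausdorff2 unfolding hausdorff2_def measure_space_def
  by (intro emeasure_measure_of_sigma) auto

section \<open>The isodiametric inequality\<close>

lemma sets_lborel_prod:
  "sets (lborel \<Otimes>\<^sub>M lborel) = sets (borel :: ('a::euclidean_space \<times> 'b::euclidean_space) measure)"
  by (metis lborel_prod sets_lborel)

text \<open>The strict inequality empties the fibres over which \<open>A\<close> is null, so that measurability of the
  projection of \<open>A\<close> is never needed.\<close>
definition steiner :: "(real \<times> real) set \<Rightarrow> (real \<times> real) set" where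
  "steiner A = {(x, y). ennreal (2 * \<bar>y\<bar>) < emeasure lborel (Pair x -` A)}"

text \<open>By Tonelli the length of the vertical section of A over x is measurable in x, so
  \<open>steiner A\<close> is cut out by a strict inequality between measurable functions.\<close>

lemma steiner_borel:
  assumes "A \<in> sets borel"
  shows "steiner A \<in> sets borel"
proof -
  have A: "A \<in> sets (lborel \<Otimes>\<^sub>M lborel)" using assms unfolding sets_lborel_prod .
  have [measurable]: "(\<lambda>x. emeasure lborel (Pair x -` A)) \<in> borel_measurable borel"
    using lborel.measurable_emeasure_Pair[OF A] by simp
  have "{z \<in> space (lborel \<Otimes>\<^sub>M lborel). ennreal (2 * \<bar>snd z\<bar>) < emeasure lborel (Pair (fst z) -` A)}
      \<in> sets (lborel \<Otimes>\<^sub>M lborel)"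
    by measurable
  moreover have "{z \<in> space (lborel \<Otimes>\<^sub>M lborel). ennreal (2 * \<bar>snd z\<bar>) < emeasure lborel (Pair (fst z) -` A)}
      = steiner A"
    by (auto simp: steiner_def space_pair_measure)
  ultimately show ?thesis unfolding sets_lborel_prod by (simp only:)
qed

text \<open>Cavalieri's principle: every vertical section is replaced by a centred open interval of
  the same length, or by the whole line if that length is infinite.\<close>

lemma emeasure_steiner:
  assumes "A \<in> sets borel"
  shows "emeasure lborel (steiner A) = emeasure lborel A"
proof -
  have *: "emeasure lborel B = (\<integral>\<^sup>+x. emeasure lborel (Pair x -` B) \<partial>lborel)"
    if "B \<in> sets borel" for B :: "(real \<times> real) set"
    using that by (subst lborel_prod[symmetric], subst lborel.emeasure_pair_measure_alt)
      (unfold sets_lborel_prod, simp_all)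
  have "emeasure lborel {y::real. ennreal (2 * \<bar>y\<bar>) < c} = c" for c
  proof (cases c)
    case (real r)
    then have "{y. ennreal (2 * \<bar>y\<bar>) < c} = {- (r / 2)<..<r / 2}"
      by (auto simp: ennreal_less_iff)
    then show ?thesis using real by (simp add: ennreal_plus[symmetric] del: ennreal_plus)
  qed simp
  then have "emeasure lborel (Pair x -` steiner A) = emeasure lborel (Pair x -` A)" for x
    by (simp add: steiner_def)
  then show ?thesis by (simp add: * assms steiner_borel)
qed

text \<open>If all differences were at most c, so would be the length of the interval from the
  infimum to the supremum of S, which contains S.\<close>

lemma real_set_spread:
  fixes S :: "real set"
  assumes "bounded S" "ennreal c < emeasure lborel S" "0 \<le> c"
  obtains p q where "p \<in> S" "q \<in> S" "c < q - p"
proof -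
  have "S \<noteq> {}" using assms(2) by auto
  have "\<exists>p\<in>S. \<exists>q\<in>S. c < q - p"
  proof (rule ccontr)
    assume "\<not> ?thesis"
    then have le: "q - p \<le> c" if "p \<in> S" "q \<in> S" for p q using that by force
    have bdd: "bdd_below S" "bdd_above S"
      using assms(1) by (auto simp: bounded_imp_bdd_below bounded_imp_bdd_above)
    have "Sup S - Inf S \<le> c"
    proof -
      have "q - c \<le> p" if "p \<in> S" "q \<in> S" for p q using le that by force
      then have "q - c \<le> Inf S" if "q \<in> S" for q
        using \<open>S \<noteq> {}\<close> that by (intro cInf_greatest) auto
      then have "q \<le> Inf S + c" if "q \<in> S" for q using that by force
      then have "Sup S \<le> Inf S + c" using \<open>S \<noteq> {}\<close> by (intro cSup_least)
      then show ?thesis by simp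
    qed
    moreover have "S \<subseteq> {Inf S..Sup S}" using bdd by (auto intro: cInf_lower cSup_upper)
    then have "emeasure lborel S \<le> emeasure lborel {Inf S..Sup S}" by (rule emeasure_mono) simp
    moreover have "emeasure lborel {Inf S..Sup S} \<le> ennreal c"
      using \<open>Sup S - Inf S \<le> c\<close> by (cases "Inf S \<le> Sup S") (auto intro: ennreal_leI)
    ultimately show False using assms(2) by (meson leD order_trans)
  qed
  then show thesis using that by blast
qed

text \<open>Over the abscissas of the two points, A contains points of heights p, q and p', q' with
  \<open>q - p\<close> above 2|y| and \<open>q' - p'\<close> above 2|y'|. The crossed differences
  \<open>q - p'\<close> and \<open>q' - p\<close> then add up to more than 2|y - y'|, so one of them
  is at least |y - y'|. The horizontal distance is unchanged, and two points of A are at least as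
  far apart.\<close>

lemma steiner_dist_le:
  assumes A: "bounded A" "\<And>z w. z \<in> A \<Longrightarrow> w \<in> A \<Longrightarrow> dist z w \<le> d"
    and z: "z \<in> steiner A" "w \<in> steiner A"
  shows "dist z w \<le> d"
proof -
  have sec: "\<exists>p q. (x, p) \<in> A \<and> (x, q) \<in> A \<and> 2 * \<bar>y\<bar> < q - p" if "(x, y) \<in> steiner A" for x y
  proof -
    have "bounded (Pair x -` A)"
      using bounded_snd[OF A(1)] by (rule bounded_subset) force
    moreover have "ennreal (2 * \<bar>y\<bar>) < emeasure lborel (Pair x -` A)"
      using that by (simp add: steiner_def)
    ultimately show ?thesis by (elim real_set_spread) auto
  qed
  obtain x y x' y' where zw: "z = (x, y)" "w = (x', y')" by (metis surj_pair)
  obtain p q p' q' where pq: "(x, p) \<in> A" "(x, q) \<in> A" "2 * \<bar>y\<bar> < q - p"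
      "(x', p') \<in> A" "(x', q') \<in> A" "2 * \<bar>y'\<bar> < q' - p'"
    using sec z unfolding zw by metis
  have "\<bar>y - y'\<bar> \<le> \<bar>q - p'\<bar> \<or> \<bar>y - y'\<bar> \<le> \<bar>q' - p\<bar>" using pq by linarith
  moreover have "dist (x, y) (x', y') \<le> dist (x, s) (x', t)" if "\<bar>y - y'\<bar> \<le> \<bar>s - t\<bar>" for s t
    using power_mono[OF that, of 2] by (simp add: dist_Pair_Pair dist_real_def)
  ultimately have "dist z w \<le> dist (x, q) (x', p') \<or> dist z w \<le> dist (x, p) (x', q')"
    unfolding zw by (metis abs_minus_commute)
  then show ?thesis using pq A(2) by (meson order_trans)
qed

lemma emeasure_lborel_swap:
  assumes "A \<in> sets borel"
  shows "emeasure lborel ((\<lambda>(x, y). (y, x)) -` A) = emeasure lborel (A :: (real \<times> real) set)"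
proof -
  have "emeasure (lborel \<Otimes>\<^sub>M lborel) A =
      emeasure (distr (lborel \<Otimes>\<^sub>M lborel) (lborel \<Otimes>\<^sub>M lborel) (\<lambda>(x, y). (y, x))) A"
    using lborel_pair.distr_pair_swap[where ?'a = real and ?'b = real] by simp
  also have "\<dots> = emeasure (lborel \<Otimes>\<^sub>M lborel) ((\<lambda>(x, y). (y, x)) -` A \<inter> space (lborel \<Otimes>\<^sub>M lborel))"
    using assms by (intro emeasure_distr measurable_pair_swap') (simp only: sets_lborel_prod)
  finally show ?thesis by (simp add: lborel_prod)
qed

text \<open>Symmetrising in both coordinates makes the set centrally symmetric without increasing its
  diameter, which forces it into the ball around the origin of half that diameter.\<close>
lemma isodiametric_prod:
  fixes A :: "(real \<times> real) set"
  assumes A: "A \<in> sets borel" "bounded A" and d: "\<And>z w. z \<in> A \<Longrightarrow> w \<in> A \<Longrightarrow> dist z w \<le> d" "0 \<le> d"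
  shows "emeasure lborel A \<le> ennreal (pi * (d / 2)\<^sup>2)"
proof -
  let ?s = "\<lambda>(x, y). (y, x) :: real \<times> real"
  \<comment> \<open>Exchanging the coordinates lets the same vertical symmetrisation act in the
    other direction.\<close>
  define B where "B = ?s -` steiner A"
  have s: "?s \<in> borel_measurable borel"
    by (intro borel_measurable_continuous_onI) (auto simp: split_beta intro!: continuous_intros)
  have B: "B \<in> sets borel"
    using measurable_sets[OF s steiner_borel[OF A(1)]] by (simp add: B_def)
  have dB: "dist z w \<le> d" if "z \<in> B" "w \<in> B" for z w
    using that steiner_dist_le[OF A(2) d(1), of "?s z" "?s w"]
    by (auto simp: B_def dist_Pair_Pair add.commute split: prod.splits)
  have bdd: "bounded B"
    unfolding bounded_two_points using dB by blast
  have sym: "- z \<in> steiner B" if "z \<in> steiner B" for z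
  proof -
    obtain x y where z: "z = (x, y)" by (metis surj_pair)
    \<comment> \<open>\<open>steiner A\<close> is even in its second coordinate, so B is even in its
      first; the second symmetrisation keeps this and adds evenness in the other coordinate.\<close>
    have "Pair (- x) -` B = Pair x -` B" by (auto simp: B_def steiner_def)
    then show ?thesis using that by (simp add: z steiner_def)
  qed
  have "steiner B \<subseteq> cball 0 (d / 2)"
  proof
    fix z assume z: "z \<in> steiner B"
    have "dist z (- z) \<le> d" by (rule steiner_dist_le[OF bdd dB z sym[OF z]])
    moreover have "dist z (- z) = 2 * norm z"
      by (metis dist_norm diff_minus_eq_add norm_scaleR scaleR_2 abs_numeral)
    ultimately show "z \<in> cball 0 (d / 2)" by simp
  qed
  then have "emeasure lborel (steiner B) \<le> emeasure lborel (cball (0 :: real \<times> real) (d / 2))"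
    by (rule emeasure_mono) simp
  also have "\<dots> = ennreal (pi * (d / 2)\<^sup>2)"
    using d(2) by (simp add: emeasure_cball unit_ball_vol_2 power2_eq_square)
  finally have "emeasure lborel (steiner B) \<le> ennreal (pi * (d / 2)\<^sup>2)" .
  moreover have "emeasure lborel B = emeasure lborel (steiner A)"
    unfolding B_def by (rule emeasure_lborel_swap[OF steiner_borel[OF A(1)]])
  ultimately show ?thesis by (simp add: emeasure_steiner A B)
qed

text \<open>Symmetrisation uses Fubini on pairs, while the planar statements are about
  \<open>real^2\<close>. Lebesgue measure is determined by its values on boxes, so comparing those
  suffices.\<close>

lemma lborel_real2: "(lborel :: (real^2) measure) = distr lborel borel (\<lambda>(x, y). vector [x, y])"
proof (rule lborel_eqI)
  let ?f = "\<lambda>(x, y). vector [x, y] :: real^2"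
  have "continuous_on UNIV (\<lambda>z :: real \<times> real. if i = 1 then fst z else snd z)" for i :: 2
    by (cases "i = 1") (auto intro!: continuous_intros)
  then have "continuous_on UNIV (\<lambda>z :: real \<times> real. \<chi> i. if i = (1 :: 2) then fst z else snd z)"
    by (intro continuous_on_vec_lambda)
  moreover have eq: "?f = (\<lambda>z. \<chi> i. if i = (1 :: 2) then fst z else snd z)"
    by (auto simp: fun_eq_iff vec_eq_iff forall_2)
  ultimately have f: "?f \<in> borel_measurable lborel"
    using borel_measurable_continuous_onI by simp
  fix l u :: "real^2" assume lu: "\<And>b. b \<in> Basis \<Longrightarrow> l \<bullet> b \<le> u \<bullet> b"
  then have lu': "l $ 1 \<le> u $ 1" "l $ 2 \<le> u $ 2"
    using lu[of "axis 1 1"] lu[of "axis 2 1"] by (auto simp: Basis_vec_def inner_axis)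
  have "?f -` box l u = box (l $ 1, l $ 2) (u $ 1, u $ 2)"
    by (auto simp: mem_box_cart forall_2 box_prod box_real)
  then have "emeasure (distr lborel borel ?f) (box l u) =
      emeasure lborel (box (l $ 1, l $ 2) (u $ 1, u $ 2))"
    using f by (simp add: emeasure_distr)
  also have "\<dots> = (\<Prod>b\<in>Basis. (u - l) \<bullet> b)"
  proof -
    have "(\<Prod>b\<in>Basis. (u - l) \<bullet> b) = (u $ 1 - l $ 1) * (u $ 2 - l $ 2)"
      by (simp add: Basis_vec_def inner_axis UNION_singleton_eq_range prod.reindex axis_eq_axis inj_on_def UNIV_2)
    then show ?thesis
      using lu' by (subst emeasure_lborel_box) (auto simp: Basis_prod_def prod.union_disjoint prod.reindex inj_on_def)
  qed
  finally show "emeasure (distr lborel borel ?f) (box l u) = (\<Prod>b\<in>Basis. (u - l) \<bullet> b)" .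
qed simp

lemma isodiametric:
  fixes S :: "(real^2) set"
  assumes "S \<in> sets borel" "bounded S"
  shows "emeasure lborel S \<le> ennreal (pi * (diameter S / 2)\<^sup>2)"
proof -
  let ?f = "\<lambda>(x, y). vector [x, y] :: real^2"
  have dist_f: "dist (?f z) (?f w) = dist z w" for z w
    by (cases z; cases w) (simp add: dist_norm norm_vec_def L2_set_def sum_2 norm_Pair)
  have f: "?f \<in> borel_measurable borel"
    by (rule borel_measurable_continuous_onI) (auto simp: continuous_on_iff dist_f)
  have d: "dist z w \<le> diameter S" if "z \<in> ?f -` S" "w \<in> ?f -` S" for z w
    using diameter_bounded_bound[OF assms(2), of "?f z" "?f w"] that by (simp add: dist_f)
  have "emeasure lborel S = emeasure lborel (?f -` S)"
    by (subst lborel_real2) (use f assms in \<open>simp add: emeasure_distr\<close>)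
  also have "\<dots> \<le> ennreal (pi * (diameter S / 2)\<^sup>2)"
  proof (rule isodiametric_prod)
    show "?f -` S \<in> sets borel" using measurable_sets[OF f assms(1)] by simp
    show "bounded (?f -` S)" unfolding bounded_two_points using d by blast
  qed (use d diameter_ge_0[OF assms(2)] in auto)
  finally show ?thesis .
qed

section \<open>Hausdorff measure in the plane\<close>

lemma hausdorff2_pre_Un:
  assumes "0 \<le> \<delta>"
  shows "hausdorff2_pre \<delta> (A \<union> B) \<le> hausdorff2_pre \<delta> A + hausdorff2_pre \<delta> B"
proof -
  have "hausdorff2_pre \<delta> (\<Union>n. binaryset A B n) \<le> (\<Sum>n. hausdorff2_pre \<delta> (binaryset A B n))"
    by (rule hausdorff2_pre_UN)
  also have "\<dots> = hausdorff2_pre \<delta> A + hausdorff2_pre \<delta> B"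
    by (rule suminf_binaryset_eq) (rule hausdorff2_pre_empty[OF assms])
  finally show ?thesis by (simp add: UN_binaryset_eq)
qed

lemma hausdorff2_pre_le_countable:
  assumes "countable I" and A: "A \<subseteq> (\<Union>i\<in>I. C i)"
    and C: "\<And>i. i \<in> I \<Longrightarrow> bounded (C i)" "\<And>i. i \<in> I \<Longrightarrow> diameter (C i) \<le> \<delta>"
    and "0 \<le> \<delta>"
  shows "hausdorff2_pre \<delta> A \<le> (\<integral>\<^sup>+i. ennreal (pi * (diameter (C i) / 2)\<^sup>2) \<partial>count_space I)"
proof -
  let ?f = "\<lambda>C. ennreal (pi * (diameter C / 2)\<^sup>2)"
  let ?t = "to_nat_on I"
  \<comment> \<open>Naturals that code no index get the empty set, of weight 0; this treats finite
    and infinite index sets alike.\<close>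
  define D where "D n = (if n \<in> ?t ` I then C (from_nat_into I n) else {})" for n
  have Dt: "D (?t i) = C i" if "i \<in> I" for i
    using that assms(1) by (simp add: D_def)
  have "hausdorff2_pre \<delta> A \<le> (\<Sum>n. ?f (D n))"
  proof (rule hausdorff2_pre_le)
    show "A \<subseteq> (\<Union>n. D n)" using A Dt by fastforce
    show "bounded (D n)" "diameter (D n) \<le> \<delta>" for n
      using C assms(1,5) by (auto simp: D_def)
  qed
  also have "\<dots> = (\<integral>\<^sup>+n. ?f (D n) \<partial>count_space UNIV)"
    by (simp add: nn_integral_count_space_nat)
  also have "\<dots> = (\<integral>\<^sup>+n. ?f (D n) \<partial>count_space (?t ` I))"
    by (rule nn_integral_count_space_eq) (auto simp: D_def)
  also have "\<dots> = (\<integral>\<^sup>+i. ?f (D (?t i)) \<partial>count_space I)"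
    using inj_on_to_nat_on[OF assms(1)]
    by (intro nn_integral_bij_count_space[symmetric]) (simp add: bij_betw_def)
  also have "\<dots> = (\<integral>\<^sup>+i. ?f (C i) \<partial>count_space I)"
    by (rule nn_integral_cong) (simp add: Dt)
  finally show ?thesis .
qed

text \<open>Covering sets are arbitrary, so they are replaced by their closures, which are Borel and
  have the same diameter; then the isodiametric inequality applies to each.\<close>

lemma lborel_le_hausdorff2_pre:
  fixes A :: "(real^2) set"
  assumes "A \<in> sets borel"
  shows "emeasure lborel A \<le> hausdorff2_pre \<delta> A"
  unfolding hausdorff2_pre_def
proof (rule INF_greatest)
  fix C :: "nat \<Rightarrow> (real^2) set"
  assume "C \<in> {C. A \<subseteq> (\<Union>i. C i) \<and> (\<forall>i. bounded (C i) \<and> diameter (C i) \<le> \<delta>)}"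
  then have C: "A \<subseteq> (\<Union>i. C i)" "\<And>i. bounded (C i)" by auto
  have "emeasure lborel A \<le> emeasure lborel (\<Union>i. closure (C i))"
  proof (rule emeasure_mono)
    show "A \<subseteq> (\<Union>i. closure (C i))"
      using C(1) closure_subset[of "C i" for i] by blast
  qed simp
  also have "\<dots> \<le> (\<Sum>i. emeasure lborel (closure (C i)))"
    by (rule emeasure_subadditive_countably) auto
  also have "\<dots> \<le> (\<Sum>i. ennreal (pi * (diameter (C i) / 2)\<^sup>2))"
  proof (intro suminf_le allI)
    fix i
    show "emeasure lborel (closure (C i)) \<le> ennreal (pi * (diameter (C i) / 2)\<^sup>2)"
      using isodiametric[of "closure (C i)"] C(2)[of i] by (simp add: diameter_closure bounded_closure)
  qed auto
  finally show "emeasure lborel A \<le> (\<Sum>i. ennreal (pi * (diameter (C i) / 2)\<^sup>2))" .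
qed

lemma emeasure_cball_real2:
  "0 \<le> r \<Longrightarrow> emeasure lborel (cball (a :: real^2) r) = ennreal (pi * r\<^sup>2)"
  by (simp add: emeasure_cball unit_ball_vol_2)

lemma small_cball_subset:
  fixes x :: "'a::metric_space"
  assumes "open U" "x \<in> U" "0 < d"
  obtains r where "0 < r" "r < d" "cball x r \<subseteq> U"
proof -
  obtain e where e: "0 < e" "ball x e \<subseteq> U" using assms by (auto elim: openE)
  have "cball x (min e d / 2) \<subseteq> ball x e" using e assms(3) by (auto simp: min_def)
  then show thesis using e assms(3) that[of "min e d / 2"] by (auto simp: min_def split: if_splits)
qed

text \<open>This disposes of the null remainder that a Vitali covering leaves behind. Here only a
  cover by fivefold enlarged discs is at hand, but a constant factor does no harm to a null
  set.\<close>

lemma hausdorff2_pre_negligible: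
  fixes N :: "(real^2) set"
  assumes "negligible N" "0 < \<delta>"
  shows "hausdorff2_pre \<delta> N = 0"
proof -
  have *: "hausdorff2_pre \<delta> N \<le> 0 + ennreal e" if e: "0 < e" for e
  proof -
    have N: "N \<in> sets lebesgue" "emeasure lebesgue N = 0"
      using assms(1) by (auto simp: negligible_iff_null_sets)
    \<comment> \<open>The divisor 25 is the area factor of a fivefold enlargement.\<close>
    obtain U where U: "open U" "N \<subseteq> U" "emeasure lebesgue (U - N) < ennreal (e / 25)"
      using sets_lebesgue_outer_open[OF N(1), of "e / 25"] e by (metis divide_pos_pos zero_less_numeral)
    have "(U - N) \<union> N = U" using U(2) by blast
    moreover have "U - N \<in> sets lebesgue" using U(1) N(1) by auto
    ultimately have "emeasure lebesgue U \<le> emeasure lebesgue (U - N) + emeasure lebesgue N"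
      using emeasure_subadditive[of "U - N" lebesgue N] N(1) by (simp only:)
    also have "\<dots> \<le> ennreal (e / 25)" using U(3) N(2) by (simp add: less_imp_le)
    finally have Ue: "emeasure lborel U \<le> ennreal (e / 25)" using U(1) by simp
    \<comment> \<open>Radius at most \<delta>/10 keeps the diameter 10 r of the enlarged disc within
      \<delta>.\<close>
    have "\<exists>r. (0 < r \<and> r \<le> \<delta> / 10) \<and> cball x r \<subseteq> U" if "x \<in> N" for x
    proof -
      have "x \<in> U" "0 < \<delta> / 10" using U(2) that assms(2) by auto
      then obtain r where "0 < r" "r < \<delta> / 10" "cball x r \<subseteq> U"
        by (rule small_cball_subset[OF U(1)])
      then show ?thesis by (auto intro: less_imp_le)
    qed
    then obtain r where r: "\<And>x. x \<in> N \<Longrightarrow> 0 < r x \<and> r x \<le> \<delta> / 10" "\<And>x. x \<in> N \<Longrightarrow> cball x (r x) \<subseteq> U"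
      by metis
    have "N \<subseteq> (\<Union>x\<in>N. cball x (r x))"
    proof
      fix x assume "x \<in> N"
      then show "x \<in> (\<Union>x\<in>N. cball x (r x))" using r(1)[of x] by (intro UN_I[of x]) auto
    qed
    then obtain C where C: "countable C" "C \<subseteq> N"
        "pairwise (\<lambda>i j. disjnt (cball i (r i)) (cball j (r j))) C"
        "N \<subseteq> (\<Union>i\<in>C. cball i (5 * r i))"
      by (rule Vitali_covering_lemma_cballs[where K = N and a = "\<lambda>x. x" and r = r, OF _ r(1)])
    have rC: "0 < r i" "10 * r i \<le> \<delta>" if "i \<in> C" for i using r(1) C(2) that by force+
    have disj: "disjoint_family_on (\<lambda>i. cball i (r i)) C"
      using C(3) by (auto simp: disjoint_family_on_def pairwise_def disjnt_def)
    have "hausdorff2_pre \<delta> N \<le>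
        (\<integral>\<^sup>+i. ennreal (pi * (diameter (cball i (5 * r i)) / 2)\<^sup>2) \<partial>count_space C)"
      using C rC \<open>0 < \<delta>\<close> by (intro hausdorff2_pre_le_countable) force+
    also have "\<dots> = (\<integral>\<^sup>+i. 25 * emeasure lborel (cball i (r i)) \<partial>count_space C)"
    proof (rule nn_integral_cong)
      fix i assume "i \<in> space (count_space C)"
      then have "0 < r i" using rC by simp
      then show "ennreal (pi * (diameter (cball i (5 * r i)) / 2)\<^sup>2) = 25 * emeasure lborel (cball i (r i))"
        by (simp add: emeasure_cball_real2 power_mult_distrib ennreal_mult'' flip: ennreal_numeral)
           (simp add: ac_simps)
    qed
    also have "\<dots> = 25 * (\<integral>\<^sup>+i. emeasure lborel (cball i (r i)) \<partial>count_space C)"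
      by (rule nn_integral_cmult) simp
    also have "\<dots> = 25 * emeasure lborel (\<Union>i\<in>C. cball i (r i))"
      using C(1) disj by (subst emeasure_UN_countable) auto
    also have "\<dots> \<le> 25 * emeasure lborel U"
      using r(2) C(2) U(1) by (intro mult_left_mono emeasure_mono) auto
    also have "\<dots> \<le> 25 * ennreal (e / 25)" by (intro mult_left_mono Ue) simp
    also have "\<dots> = ennreal e" using e by (simp add: ennreal_mult'[symmetric] flip: ennreal_numeral)
    finally show ?thesis by simp
  qed
  have "hausdorff2_pre \<delta> N \<le> 0" by (rule ennreal_le_epsilon) (rule *)
  then show ?thesis by simp
qed

text \<open>Small disjoint discs inside U exhaust it up to a null set, and the weight of a disc is
  exactly its area; so, unlike a fivefold enlargement, this loses no factor.\<close>

lemma hausdorff2_pre_open_le: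
  fixes U :: "(real^2) set"
  assumes "open U" "0 < \<delta>"
  shows "hausdorff2_pre \<delta> U \<le> emeasure lborel U"
proof -
  define K where "K = {(x, r). 0 < r \<and> r \<le> \<delta> / 2 \<and> cball x r \<subseteq> U}"
  have K: "\<exists>i. i \<in> K \<and> x \<in> cball (fst i) (snd i) \<and> snd i < d" if x: "x \<in> U" and d: "0 < d" for x d
  proof -
    have "0 < min (\<delta> / 2) d" using assms(2) d by simp
    then obtain r where "0 < r" "r < min (\<delta> / 2) d" "cball x r \<subseteq> U"
      using small_cball_subset[OF assms(1) x] by blast
    then show ?thesis by (intro exI[of _ "(x, r)"]) (simp add: K_def)
  qed
  obtain C where C: "countable C" "C \<subseteq> K"
      "pairwise (\<lambda>i j. disjnt (cball (fst i) (snd i)) (cball (fst j) (snd j))) C"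
      "negligible (U - (\<Union>i\<in>C. cball (fst i) (snd i)))"
  proof (rule Vitali_covering_theorem_cballs[of K snd U fst])
    show "0 < snd i" if "i \<in> K" for i using that by (auto simp: K_def)
  qed (use K in blast)+
  have CK: "0 < snd i" "2 * snd i \<le> \<delta>" "cball (fst i) (snd i) \<subseteq> U" if "i \<in> C" for i
    using subsetD[OF C(2) that] by (simp_all add: K_def case_prod_beta)
  define W where "W = (\<Union>i\<in>C. cball (fst i) (snd i))"
  have disj: "disjoint_family_on (\<lambda>i. cball (fst i) (snd i)) C"
    using C(3) by (auto simp: disjoint_family_on_def pairwise_def disjnt_def)
  have "hausdorff2_pre \<delta> U \<le> hausdorff2_pre \<delta> (W \<union> (U - W))"
    by (rule hausdorff2_pre_mono) auto
  also have "\<dots> \<le> hausdorff2_pre \<delta> W + hausdorff2_pre \<delta> (U - W)"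
    using assms(2) by (intro hausdorff2_pre_Un) simp
  also have "\<dots> = hausdorff2_pre \<delta> W"
    using hausdorff2_pre_negligible[OF C(4) assms(2)] by (simp add: W_def)
  also have "\<dots> \<le> (\<integral>\<^sup>+i. ennreal (pi * (diameter (cball (fst i) (snd i)) / 2)\<^sup>2) \<partial>count_space C)"
    using C(1) CK assms(2) by (intro hausdorff2_pre_le_countable) (force simp: W_def)+
  also have "\<dots> = (\<integral>\<^sup>+i. emeasure lborel (cball (fst i) (snd i)) \<partial>count_space C)"
  proof (rule nn_integral_cong)
    fix i assume "i \<in> space (count_space C)"
    then have "0 < snd i" using CK by simp
    then show "ennreal (pi * (diameter (cball (fst i) (snd i)) / 2)\<^sup>2) = emeasure lborel (cball (fst i) (snd i))"
      by (simp add: emeasure_cball_real2)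
  qed
  also have "\<dots> = emeasure lborel W"
    unfolding W_def using C(1) disj by (subst emeasure_UN_countable) auto
  also have "\<dots> \<le> emeasure lborel U"
    using CK(3) assms(1) by (intro emeasure_mono) (auto simp: W_def)
  finally show ?thesis .
qed

theorem hausdorff2_outer_eq_lborel:
  fixes A :: "(real^2) set"
  assumes "A \<in> sets borel"
  shows "hausdorff2_outer A = emeasure lborel A"
proof (rule antisym)
  show "hausdorff2_outer A \<le> emeasure lborel A"
  proof (rule hausdorff2_outer_leI)
    fix \<delta> :: real assume \<delta>: "0 < \<delta>"
    show "hausdorff2_pre \<delta> A \<le> emeasure lborel A"
    proof (rule ennreal_le_epsilon)
      fix e :: real assume "0 < e"
      then obtain U where U: "open U" "A \<subseteq> U" "emeasure lborel (U - A) < e"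
        by (rule outer_regular_lborel[OF assms])
      have "hausdorff2_pre \<delta> A \<le> hausdorff2_pre \<delta> U" by (rule hausdorff2_pre_mono[OF U(2)])
      also have "\<dots> \<le> emeasure lborel U" by (rule hausdorff2_pre_open_le[OF U(1) \<delta>])
      also have "\<dots> = emeasure lborel A + emeasure lborel (U - A)"
      proof (subst plus_emeasure)
        show "emeasure lborel U = emeasure lborel (A \<union> (U - A))"
          using U(2) by (simp add: Un_absorb1)
      qed (use U(1) assms in auto)
      also have "\<dots> \<le> emeasure lborel A + e" using U by (intro add_left_mono) simp
      finally show "hausdorff2_pre \<delta> A \<le> emeasure lborel A + e" .
    qed
  qed
  \<comment> \<open>The lower bound is available at every scale; 1 is an arbitrary choice.\<close>
  show "emeasure lborel A \<le> hausdorff2_outer A"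
    using lborel_le_hausdorff2_pre[OF assms, of 1] hausdorff2_pre_le_outer[of 1 A] by simp
qed

section \<open>Isometric invariance\<close>

lemma diameter_isometry:
  assumes "\<And>z w. dist (f z) (f w) = dist z w"
  shows "diameter (f ` S) = diameter S"
proof -
  have "f ` S \<times> f ` S = map_prod f f ` (S \<times> S)" by auto
  then show ?thesis
    unfolding diameter_def by (simp add: image_image case_prod_beta assms)
qed

text \<open>Covers are carried in both directions: forward by images, which keep diameters, and
  backward by preimages. As f need not be onto, a preimage may have smaller diameter than the set it
  came from, which is the favourable direction.\<close>

lemma hausdorff2_outer_isometry:
  fixes f :: "'a::metric_space \<Rightarrow> 'b::metric_space"
  assumes f: "\<And>z w. dist (f z) (f w) = dist z w"
  shows "hausdorff2_outer (f ` A) = hausdorff2_outer A"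
proof -
  let ?h = "\<lambda>C. ennreal (pi * (diameter C / 2)\<^sup>2)"
  have bdd: "bounded (f ` C) \<longleftrightarrow> bounded C" for C
    unfolding bounded_two_points by (auto simp: f)
  have "hausdorff2_pre \<delta> (f ` A) = hausdorff2_pre \<delta> A" for \<delta>
  proof (rule antisym)
    show "hausdorff2_pre \<delta> (f ` A) \<le> hausdorff2_pre \<delta> A"
      unfolding hausdorff2_pre_def[of _ A]
    proof (rule INF_greatest, clarsimp)
      fix C :: "nat \<Rightarrow> 'a set" assume C: "A \<subseteq> (\<Union>i. C i)" "\<forall>i. bounded (C i) \<and> diameter (C i) \<le> \<delta>"
      have "hausdorff2_pre \<delta> (f ` A) \<le> (\<Sum>i. ?h (f ` C i))"
        using C by (intro hausdorff2_pre_le) (fastforce, auto simp: bdd diameter_isometry f)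
      then show "hausdorff2_pre \<delta> (f ` A) \<le> (\<Sum>i. ?h (C i))"
        by (simp add: diameter_isometry f)
    qed
    show "hausdorff2_pre \<delta> A \<le> hausdorff2_pre \<delta> (f ` A)"
      unfolding hausdorff2_pre_def[of _ "f ` A"]
    proof (rule INF_greatest, clarsimp)
      fix C :: "nat \<Rightarrow> 'b set" assume C: "f ` A \<subseteq> (\<Union>i. C i)" "\<forall>i. bounded (C i) \<and> diameter (C i) \<le> \<delta>"
      have sub: "f ` (f -` C i) \<subseteq> C i" for i by auto
      have b: "bounded (f -` C i)" for i
        using bounded_subset[OF _ sub] C bdd by blast
      have d: "diameter (f -` C i) \<le> diameter (C i)" for i
        using diameter_subset[OF sub] C(2) by (simp only: diameter_isometry[of f, OF f])
      have "hausdorff2_pre \<delta> A \<le> (\<Sum>i. ?h (f -` C i))"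
      proof (rule hausdorff2_pre_le)
        show "A \<subseteq> (\<Union>i. f -` C i)" using C(1) by blast
        show "diameter (f -` C i) \<le> \<delta>" for i
          by (rule order_trans[OF d]) (use C(2) in simp)
      qed (rule b)
      also have "\<dots> \<le> (\<Sum>i. ?h (C i))"
        using d diameter_ge_0[OF b]
        by (intro suminf_le allI ennreal_leI mult_left_mono power_mono) (auto simp: divide_right_mono)
      finally show "hausdorff2_pre \<delta> A \<le> (\<Sum>i. ?h (C i))" .
    qed
  qed
  then show ?thesis unfolding hausdorff2_outer_def by simp
qed

section \<open>Triangles\<close>

text \<open>A face is only given as a set; this names its vertices, with a chosen one first. Affine
  independence of the set {x, v, w} does not exclude repeated arguments, so distinctness is stated
  separately.\<close>

definition is_triangle :: "real^3 \<Rightarrow> real^3 \<Rightarrow> real^3 \<Rightarrow> (real^3) set \<Rightarrow> bool" where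
  "is_triangle x v w F \<longleftrightarrow> F = convex hull {x, v, w} \<and> x \<noteq> v \<and> x \<noteq> w \<and> v \<noteq> w \<and> \<not> affine_dependent {x, v, w}"

text \<open>The Gram determinant: the squared area of the parallelogram spanned by p and q.\<close>

definition gram :: "'a::real_inner \<Rightarrow> 'a \<Rightarrow> real" where
  "gram p q = (p \<bullet> p) * (q \<bullet> q) - (p \<bullet> q)\<^sup>2"

lemma simplex_2_vertices:
  assumes "2 simplex F" "x \<in> face_vertices F"
  obtains v w where "is_triangle x v w F"
proof -
  obtain C where C: "\<not> affine_dependent C" "int (card C) = 2 + 1" "F = convex hull C"
    using assms(1) by (auto simp: simplex_def)
  have "x \<in> C"
    using assms(2) C extreme_point_of_convex_hull by (auto simp: face_vertices_def)
  obtain a b c where abc: "C = {a, b, c}" "a \<noteq> b" "b \<noteq> c" "a \<noteq> c"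
    using C(2) card_3_iff[of C] by auto
  have "{a, b, c} = {b, c, a}" "{a, b, c} = {c, a, b}" by auto
  then have "is_triangle a b c F" "is_triangle b c a F" "is_triangle c a b F"
    using abc C unfolding is_triangle_def by metis+
  then show thesis using \<open>x \<in> C\<close> abc(1) that by blast
qed

lemma triangle_swap:
  assumes "is_triangle x v w F"
  shows "is_triangle x w v F"
proof -
  have "{x, w, v} = {x, v, w}" by auto
  then show ?thesis using assms unfolding is_triangle_def by (simp only:) blast
qed

lemma triangle_rotate:
  assumes "is_triangle x v w F"
  shows "is_triangle v w x F"
proof -
  have "{v, w, x} = {x, v, w}" by auto
  then show ?thesis using assms unfolding is_triangle_def by (simp only:) blast
qed

lemma face_vertices_triangle:
  assumes "is_triangle x v w F"
  shows "face_vertices F = {x, v, w}"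
proof -
  have F: "F = convex hull {x, v, w}" and ind: "\<not> affine_dependent {x, v, w}"
    using assms unfolding is_triangle_def by blast+
  show ?thesis
    unfolding face_vertices_def F extreme_point_of_convex_hull_affine_independent[OF ind]
    by (rule Collect_mem_eq)
qed

lemma triangle_subset: "is_triangle x v w F \<Longrightarrow> {x, v, w} \<subseteq> F"
  unfolding is_triangle_def using hull_subset[of "{x, v, w}" convex] by blast

lemma compact_triangle: "is_triangle x v w F \<Longrightarrow> compact F"
  by (simp add: is_triangle_def finite_imp_compact_convex_hull)

lemma triangle_points:
  assumes "is_triangle x v w F" "y \<in> F"
  obtains s t where "y = x + s *\<^sub>R (v - x) + t *\<^sub>R (w - x)"
proof -
  have "y \<in> {x + s *\<^sub>R (v - x) + t *\<^sub>R (w - x) | s t. 0 \<le> s \<and> 0 \<le> t \<and> s + t \<le> 1}"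
    using assms unfolding is_triangle_def convex_hull_3_alt by simp
  then show thesis using that by blast
qed

text \<open>Equality in the Cauchy-Schwarz inequality would make the three vertices
  collinear.\<close>

lemma triangle_gram_pos:
  assumes "is_triangle x v w F"
  shows "0 < gram (v - x) (w - x)"
proof -
  have "\<not> collinear {v, x, w}"
    using assms by (auto simp: is_triangle_def collinear_3_eq_affine_dependent insert_commute)
  then have "\<bar>(v - x) \<bullet> (w - x)\<bar> \<noteq> norm (v - x) * norm (w - x)"
    by (simp add: norm_cauchy_schwarz_equal collinear_3[of v x w])
  then have "\<bar>(v - x) \<bullet> (w - x)\<bar> < norm (v - x) * norm (w - x)"
    using Cauchy_Schwarz_ineq2[of "v - x" "w - x"] by linarith
  then have "\<bar>(v - x) \<bullet> (w - x)\<bar>\<^sup>2 < (norm (v - x) * norm (w - x))\<^sup>2"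
    by (intro power_strict_mono) auto
  then show ?thesis
    by (simp add: gram_def power_mult_distrib power2_norm_eq_inner)
qed

lemma face_direction_triangle:
  assumes "is_triangle x v w F"
  shows "face_direction F = span {v - x, w - x}"
proof
  have F: "x \<in> F" "v \<in> F" "w \<in> F" using triangle_subset[OF assms] by auto
  show "span {v - x, w - x} \<subseteq> face_direction F"
    unfolding face_direction_def by (rule span_mono) (use F in blast)
  show "face_direction F \<subseteq> span {v - x, w - x}"
    unfolding face_direction_def
  proof (rule span_minimal)
    have "y - z \<in> span {v - x, w - x}" if yz: "y \<in> F" "z \<in> F" for y z
    proof -
      obtain s t s' t' where yz': "y = x + s *\<^sub>R (v - x) + t *\<^sub>R (w - x)" "z = x + s' *\<^sub>R (v - x) + t' *\<^sub>R (w - x)"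
        using triangle_points[OF assms yz(1)] triangle_points[OF assms yz(2)] by metis
      then have "y - z = (s - s') *\<^sub>R (v - x) + (t - t') *\<^sub>R (w - x)"
        unfolding yz' by (simp add: algebra_simps)
      then show ?thesis by (simp add: span_add span_scale span_base)
    qed
    then show "{y - z |y z. y \<in> F \<and> z \<in> F} \<subseteq> span {v - x, w - x}" by blast
  qed simp
qed

lemma subspace_face_direction: "subspace (face_direction F)"
  by (simp add: face_direction_def)

lemma dim_face_direction:
  assumes "is_triangle x v w F"
  shows "dim (face_direction F) = 2"
proof -
  have "independent ((\<lambda>y. y - x) ` {v, w})"
    using assms affine_dependent_iff_dependent[of x "{v, w}"] by (auto simp: is_triangle_def)
  then have "independent {v - x, w - x}" by simp
  moreover have "card {v - x, w - x} = 2" using assms by (simp add: is_triangle_def)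
  ultimately show ?thesis
    by (simp add: face_direction_triangle[OF assms] dim_eq_card_independent)
qed

section \<open>Hausdorff measure of a triangle and of its edges\<close>

lemma hausdorff2_planar_triangle:
  fixes T :: "real^2 \<Rightarrow> real^3"
  assumes "\<And>z w. dist (T z) (T w) = dist z w"
  shows "hausdorff2_outer (T ` (convex hull {a, b, c})) =
    ennreal (\<bar>(c $ 1 - a $ 1) * (b $ 2 - a $ 2) - (b $ 1 - a $ 1) * (c $ 2 - a $ 2)\<bar> / 2)"
proof -
  have c: "compact (convex hull {a, b, c})" by (simp add: finite_imp_compact_convex_hull)
  then have "hausdorff2_outer (T ` (convex hull {a, b, c})) = emeasure lborel (convex hull {a, b, c})"
    by (simp add: hausdorff2_outer_isometry[OF assms] hausdorff2_outer_eq_lborel borel_compact)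
  also have "\<dots> = ennreal (measure lborel (convex hull {a, b, c}))"
    using emeasure_bounded_finite[OF compact_imp_bounded[OF c]]
    by (intro emeasure_eq_ennreal_measure) auto
  finally show ?thesis by (simp add: content_triangle)
qed

text \<open>Gram-Schmidt on the two edge vectors at x gives an orthonormal frame of the plane of F.
  In these coordinates one side lies on the first axis and r is the height over it, so base times
  height is the root of the Gram determinant.\<close>

lemma triangle_isometry:
  assumes "is_triangle x v w F"
  obtains T :: "real^2 \<Rightarrow> real^3" and c r
  where "\<And>z z'. dist (T z) (T z') = dist z z'"
    "\<And>A. convex hull (T ` A) = T ` (convex hull A)"
    "T 0 = x" "T (vector [norm (v - x), 0]) = v" "T (vector [c, r]) = w"
    "0 < r" "norm (v - x) * r = sqrt (gram (v - x) (w - x))"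
proof -
  define p where "p = v - x"
  define q where "q = w - x"
  have G: "0 < gram p q" unfolding p_def q_def by (rule triangle_gram_pos[OF assms])
  have np: "0 < norm p" using assms by (auto simp: p_def is_triangle_def)
  then have pp: "0 < p \<bullet> p" by (simp add: dot_square_norm)
  define k where "k = (p \<bullet> q) / (p \<bullet> p)"
  define q' where "q' = q - k *\<^sub>R p"
  have pq': "p \<bullet> q' = 0" using pp by (simp add: q'_def k_def inner_diff_right)
  have "(p \<bullet> p) * (q' \<bullet> q') = (p \<bullet> p) * (q \<bullet> q')"
    using pq' by (simp add: q'_def inner_diff_left)
  also have "\<dots> = gram p q"
    using pp by (simp add: q'_def inner_diff_right k_def gram_def field_simps power2_eq_square inner_commute)
  finally have gq: "(p \<bullet> p) * (q' \<bullet> q') = gram p q" .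
  then have nq: "0 < norm q'"
    using G by (metis inner_zero_left mult_zero_right norm_zero zero_less_norm_iff less_irrefl)
  define u1 where "u1 = p /\<^sub>R norm p"
  define u2 where "u2 = q' /\<^sub>R norm q'"
  have u: "u1 \<bullet> u1 = 1" "u2 \<bullet> u2 = 1" "u1 \<bullet> u2 = 0"
    using np nq pq' by (auto simp: u1_def u2_def dot_square_norm power2_eq_square)
  define L :: "real^2 \<Rightarrow> real^3" where "L z = (z $ 1) *\<^sub>R u1 + (z $ 2) *\<^sub>R u2" for z
  have L: "linear L"
    by (rule linearI) (simp_all add: L_def algebra_simps)
  have "L z \<bullet> L z = z $ 1 * z $ 1 + z $ 2 * z $ 2" for z
    using u by (simp add: L_def inner_add_left inner_add_right inner_commute[of u2 u1])
  then have "L z \<bullet> L z = z \<bullet> z" for z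
    by (simp add: inner_vec_def sum_2)
  then have nL: "norm (L z) = norm z" for z by (simp add: norm_eq_sqrt_inner)
  define T where "T z = x + L z" for z
  show thesis
  proof (rule that[of T "k * norm p" "norm q'"])
    show "dist (T z) (T z') = dist z z'" for z z'
      by (simp add: T_def dist_norm nL flip: linear_diff[OF L])
    show "convex hull (T ` A) = T ` (convex hull A)" for A
    proof -
      have T: "T = (\<lambda>y. x + y) \<circ> L" by (auto simp: T_def)
      show ?thesis
        unfolding T image_comp[symmetric] by (simp add: convex_hull_translation convex_hull_linear_image[OF L])
    qed
    show "T 0 = x" by (simp add: T_def L_def)
    show "T (vector [norm (v - x), 0]) = v"
      using np by (simp add: T_def L_def u1_def p_def)
    show "T (vector [k * norm p, norm q']) = w"
      using np nq by (simp add: T_def L_def u1_def u2_def q'_def q_def)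
    show "0 < norm q'" by (rule nq)
    have "(norm p * norm q')\<^sup>2 = gram p q"
      using gq by (simp add: power_mult_distrib power2_norm_eq_inner)
    then show "norm (v - x) * norm q' = sqrt (gram (v - x) (w - x))"
      unfolding p_def[symmetric] q_def[symmetric] by (metis norm_ge_zero mult_nonneg_nonneg real_sqrt_unique)
  qed
qed

lemma hausdorff2_triangle:
  assumes "is_triangle x v w F"
  shows "hausdorff2_outer F = ennreal (sqrt (gram (v - x) (w - x)) / 2)"
proof -
  obtain T :: "real^2 \<Rightarrow> real^3" and c r where T: "\<And>z z'. dist (T z) (T z') = dist z z'"
    "\<And>A. convex hull (T ` A) = T ` (convex hull A)"
    "T 0 = x" "T (vector [norm (v - x), 0]) = v" "T (vector [c, r]) = w"
    "0 < r" "norm (v - x) * r = sqrt (gram (v - x) (w - x))"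
    using triangle_isometry[OF assms] by metis
  have "F = T ` (convex hull {0, vector [norm (v - x), 0], vector [c, r]})"
    unfolding T(2)[symmetric] using assms T(3-5) by (simp add: is_triangle_def)
  then show ?thesis
    using T(6,7) triangle_gram_pos[OF assms]
    by (simp add: hausdorff2_planar_triangle[OF T(1)] abs_of_nonneg)
qed

lemma hausdorff2_triangle_frontier:
  assumes "is_triangle x v w F"
  shows "hausdorff2_outer (F - rel_interior F) = 0"
proof -
  have edge: "hausdorff2_outer (convex hull {x, v}) = 0" if tri: "is_triangle x v w F" for x v w
  proof -
    obtain T :: "real^2 \<Rightarrow> real^3" and c r where T: "\<And>z z'. dist (T z) (T z') = dist z z'"
      "\<And>A. convex hull (T ` A) = T ` (convex hull A)"
      "T 0 = x" "T (vector [norm (v - x), 0]) = v"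
      using triangle_isometry[OF tri] by metis
    let ?v = "vector [norm (v - x), 0] :: real^2"
    \<comment> \<open>An edge is a degenerate triangle with a repeated vertex, for which the area
      formula yields 0.\<close>
    have "convex hull {x, v} = T ` (convex hull {0, ?v, ?v})"
      unfolding T(2)[symmetric] using T(3,4) by simp
    then show ?thesis using hausdorff2_planar_triangle[OF T(1), of 0 ?v ?v] by simp
  qed
  have "F - rel_interior F = rel_frontier F"
    using compact_imp_closed[OF compact_triangle[OF assms]] by (simp add: rel_frontier_def)
  also have "\<dots> = (\<Union>a\<in>{x, v, w}. convex hull ({x, v, w} - {a}))"
    using assms rel_frontier_convex_hull_cases[of "{x, v, w}"] by (auto simp: is_triangle_def)
  also have "\<dots> = convex hull {v, w} \<union> (convex hull {w, x} \<union> convex hull {x, v})"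
  proof -
    have "{x, v, w} - {x} = {v, w}" "{x, v, w} - {v} = {w, x}" "{x, v, w} - {w} = {x, v}"
      using assms by (auto simp: is_triangle_def)
    then show ?thesis by simp
  qed
  finally have "hausdorff2_outer (F - rel_interior F) \<le> hausdorff2_outer (convex hull {v, w}) +
      (hausdorff2_outer (convex hull {w, x}) + hausdorff2_outer (convex hull {x, v}))"
    by (simp only:) (rule order_trans[OF hausdorff2_outer_Un add_left_mono[OF hausdorff2_outer_Un]])
  also have "\<dots> = 0"
    using assms by (simp add: edge[of x v w] edge[of v w x] edge[of w x v] triangle_rotate)
  finally show ?thesis by simp
qed

section \<open>Gradients along a face, cotangents and area\<close>

lemma tangential_gradient_affine:
  assumes "t \<in> face_direction F" "y \<in> rel_interior F"
    and g: "\<And>z. z \<in> F \<Longrightarrow> g z = g y + t \<bullet> (z - y)"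
  shows "tangential_gradient (face_direction F) g y = t"
proof (rule tangential_gradient_unique[OF subspace_face_direction assms(1)])
  let ?P = "face_direction F"
  obtain e where e: "0 < e" "ball y e \<inter> affine hull F \<subseteq> F" and y: "y \<in> F"
    using assms(2) by (auto simp: mem_rel_interior_ball)
  \<comment> \<open>The derivative is taken within the plane through y. Since this plane lies in the
    affine hull, points of it close to y are in F, where g is known to be affine.\<close>
  have sub: "(+) y ` ?P \<subseteq> affine hull F"
  proof -
    have yh: "y \<in> affine hull F" using y by (rule hull_inc)
    define Q where "Q = (\<lambda>z. - y + z) ` (affine hull F)"
    have Q: "subspace Q" unfolding Q_def by (rule affine_diffs_subspace[OF affine_affine_hull yh])
    have "z - y \<in> Q" if "z \<in> F" for z
      using hull_inc[OF that, of affine] by (auto simp: Q_def)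
    then have "a - b \<in> Q" if "a \<in> F" "b \<in> F" for a b
      using subspace_diff[OF Q, of "a - y" "b - y"] that by simp
    then have "?P \<subseteq> Q" unfolding face_direction_def by (intro span_minimal Q) auto
    then show ?thesis by (auto simp: Q_def)
  qed
  have "((\<lambda>z. g y + t \<bullet> (z - y)) has_derivative (\<lambda>h. t \<bullet> h)) (at y within (+) y ` ?P)"
    by (auto intro!: derivative_eq_intros)
  then show "(g has_derivative (\<lambda>h. t \<bullet> h)) (at y within (+) y ` ?P)"
  proof (rule has_derivative_transform_within[OF _ e(1)])
    show "y \<in> (+) y ` ?P" using subspace_0[OF subspace_face_direction, of F] by force
    fix z assume "z \<in> (+) y ` ?P" "dist z y < e"
    then have "z \<in> ball y e \<inter> affine hull F" using sub by (auto simp: dist_commute)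
    then have "z \<in> F" using e(2) by blast
    then show "g y + t \<bullet> (z - y) = g z" using g by simp
  qed
qed

text \<open>Cramer's rule for the coefficients, in the basis p, q, of the vector with inner product
  -1 with both. The numerators are the inner products that reappear in the cotangents of the angles
  at the far ends of q and p.\<close>

definition nodal_gradient :: "real^3 \<Rightarrow> real^3 \<Rightarrow> real^3" where
  "nodal_gradient p q =
     - ((q \<bullet> (q - p)) *\<^sub>R p + (p \<bullet> (p - q)) *\<^sub>R q) /\<^sub>R gram p q"

lemma nodal_gradient_inner:
  assumes "0 < gram p q"
  shows "nodal_gradient p q \<bullet> p = -1" "nodal_gradient p q \<bullet> q = -1"
proof -
  have "((q \<bullet> (q - p)) *\<^sub>R p + (p \<bullet> (p - q)) *\<^sub>R q) \<bullet> p = gram p q"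
    "((q \<bullet> (q - p)) *\<^sub>R p + (p \<bullet> (p - q)) *\<^sub>R q) \<bullet> q = gram p q"
    by (simp_all add: gram_def inner_commute[of q p] algebra_simps power2_eq_square inner_add_left inner_diff_right)
  then show "nodal_gradient p q \<bullet> p = -1" "nodal_gradient p q \<bullet> q = -1"
    using assms unfolding nodal_gradient_def by (simp_all only: inner_scaleR_left inner_minus_left) simp_all
qed

text \<open>One minus the squared cosine is the Gram determinant over the squared product of the
  lengths, so the lengths cancel in cosine over sine.\<close>

lemma cot_angle_at:
  assumes "0 < gram (p - w) (q - w)"
  shows "cot (angle_at p w q) = ((p - w) \<bullet> (q - w)) / sqrt (gram (p - w) (q - w))"
proof -
  define a where "a = p - w"
  define b where "b = q - w"
  define n where "n = norm a * norm b"
  define c where "c = a \<bullet> b"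
  have G: "gram a b = n\<^sup>2 - c\<^sup>2"
    by (simp add: gram_def n_def c_def power_mult_distrib power2_norm_eq_inner)
  have n: "0 < n"
    using assms unfolding n_def by (auto simp: gram_def a_def b_def intro!: mult_pos_pos)
  have "\<bar>c\<bar> \<le> n" unfolding n_def c_def by (rule Cauchy_Schwarz_ineq2)
  then have u: "-1 \<le> c / n" "c / n \<le> 1" using n by (auto simp: field_simps)
  have "1 - (c / n)\<^sup>2 = gram a b / n\<^sup>2" using n by (simp add: G field_simps)
  then have "sin (arccos (c / n)) = sqrt (gram a b) / n"
    using n u by (simp add: sin_arccos real_sqrt_divide)
  then have "cot (arccos (c / n)) = c / sqrt (gram a b)"
    using n u by (simp add: cot_def)
  then show ?thesis by (simp add: angle_at_def a_def b_def n_def c_def)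
qed

lemma opposite_angle_triangle:
  assumes "is_triangle x v w F"
  shows "opposite_angle F x v = angle_at x w v"
proof -
  have "(THE w'. w' \<in> face_vertices F \<and> w' \<noteq> x \<and> w' \<noteq> v) = w"
    unfolding face_vertices_triangle[OF assms]
    using assms by (intro the_equality) (auto simp: is_triangle_def)
  then show ?thesis by (simp add: opposite_angle_def)
qed

text \<open>The Gram determinant is the same at all three vertices, so both cotangents have
  denominator \<open>sqrt (gram p q)\<close>; multiplying the gradient by half this root leaves the
  same denominator. The coefficient of p belongs to the angle at w, opposite to the edge from x to
  v.\<close>

lemma area_nodal_gradient:
  assumes "is_triangle x v w F"
  shows "(sqrt (gram (v - x) (w - x)) / 2) *\<^sub>R nodal_gradient (v - x) (w - x) =
    - (1/2) *\<^sub>R (cot (opposite_angle F x v) *\<^sub>R (v - x) + cot (opposite_angle F x w) *\<^sub>R (w - x))"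
proof -
  define p where "p = v - x"
  define q where "q = w - x"
  have G: "0 < gram p q" unfolding p_def q_def by (rule triangle_gram_pos[OF assms])
  have *: "x - w = - q" "v - w = p - q" "x - v = - p" "w - v = q - p" by (simp_all add: p_def q_def)
  have g: "gram (- q) (p - q) = gram p q" "gram (- p) (q - p) = gram p q"
    by (simp_all add: gram_def algebra_simps inner_diff_left inner_diff_right power2_eq_square inner_commute[of q p])
  have cots: "cot (angle_at x w v) = (q \<bullet> (q - p)) / sqrt (gram p q)"
    "cot (angle_at x v w) = (p \<bullet> (p - q)) / sqrt (gram p q)"
    using cot_angle_at[of x w v] cot_angle_at[of x v w] G
    unfolding * g by (simp_all add: inner_diff_right)
  have s: "sqrt (gram p q) / gram p q = 1 / sqrt (gram p q)"
    using G by (simp add: field_simps)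
  have "(a / 2) *\<^sub>R (- M /\<^sub>R g) = (- (1/2) * (a / g)) *\<^sub>R M" for a g :: real and M :: "real^3"
    by (cases "g = 0") (simp_all add: inverse_eq_divide)
  then have "(sqrt (gram p q) / 2) *\<^sub>R nodal_gradient p q =
      (- (1/2) * (sqrt (gram p q) / gram p q)) *\<^sub>R ((q \<bullet> (q - p)) *\<^sub>R p + (p \<bullet> (p - q)) *\<^sub>R q)"
    unfolding nodal_gradient_def .
  moreover have "(- (1/2) * (1 / s)) *\<^sub>R (a *\<^sub>R p + b *\<^sub>R q) = - (1/2) *\<^sub>R ((a / s) *\<^sub>R p + (b / s) *\<^sub>R q)"
    for a b s :: real
    by (simp only: scaleR_add_right scaleR_scaleR) simp
  ultimately have "(sqrt (gram p q) / 2) *\<^sub>R nodal_gradient p q =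
      - (1/2) *\<^sub>R (((q \<bullet> (q - p)) / sqrt (gram p q)) *\<^sub>R p + ((p \<bullet> (p - q)) / sqrt (gram p q)) *\<^sub>R q)"
    unfolding s by (simp only:)
  then show ?thesis
    unfolding opposite_angle_triangle[OF assms] opposite_angle_triangle[OF triangle_swap[OF assms]] cots
    unfolding p_def q_def .
qed

section \<open>The varifold of a triangulation\<close>

lemma plane_proj_unique:
  assumes "subspace P" "p \<in> P" "\<And>q. q \<in> P \<Longrightarrow> (y - p) \<bullet> q = 0"
  shows "plane_proj P y = p"
proof -
  let ?u = "p - plane_proj P y"
  have u: "?u \<in> P" using assms plane_proj_props(1) by (simp add: subspace_diff)
  have "(y - plane_proj P y) \<bullet> ?u = 0" "(y - p) \<bullet> ?u = 0"
    using plane_proj_props(2)[OF assms(1) u] assms(3)[OF u] by auto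
  then have "?u \<bullet> ?u = 0" by (simp add: inner_diff_left)
  then show ?thesis by simp
qed

lemma linear_plane_proj:
  assumes "subspace P"
  shows "linear (plane_proj P)"
proof (rule linearI)
  note pp = plane_proj_props[OF assms]
  show "plane_proj P (y + z) = plane_proj P y + plane_proj P z" for y z
  proof (rule plane_proj_unique[OF assms subspace_add[OF assms pp(1) pp(1)]])
    fix q assume "q \<in> P"
    then have "(y - plane_proj P y) \<bullet> q = 0" "(z - plane_proj P z) \<bullet> q = 0" using pp(2) by auto
    then show "(y + z - (plane_proj P y + plane_proj P z)) \<bullet> q = 0"
      by (simp add: inner_diff_left inner_add_left)
  qed
  show "plane_proj P (c *\<^sub>R y) = c *\<^sub>R plane_proj P y" for c y
  proof (rule plane_proj_unique[OF assms subspace_scale[OF assms pp(1)]])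
    fix q assume "q \<in> P"
    then have "(y - plane_proj P y) \<bullet> q = 0" using pp(2) by auto
    then show "(c *\<^sub>R y - c *\<^sub>R plane_proj P y) \<bullet> q = 0"
      by (simp add: inner_diff_left)
  qed
qed

lemma plane_eq_fixpoints:
  assumes "subspace P"
  shows "P = {y. plane_proj P y = y}"
proof
  show "P \<subseteq> {y. plane_proj P y = y}"
    by (auto intro!: plane_proj_unique[OF assms])
  show "{y. plane_proj P y = y} \<subseteq> P"
    using plane_proj_props(1)[OF assms] by (metis (lifting) mem_Collect_eq subsetI)
qed

lemma inj_on_plane_matrix: "inj_on (\<lambda>P. matrix (plane_proj P)) {P. subspace P \<and> dim P = 2}"
proof (rule inj_onI)
  fix P Q assume "P \<in> {P. subspace P \<and> dim P = 2}" "Q \<in> {P. subspace P \<and> dim P = 2}"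
    and eq: "matrix (plane_proj P) = matrix (plane_proj Q)"
  then have sub: "subspace P" "subspace Q" by auto
  have "plane_proj P y = plane_proj Q y" for y
    using fun_cong[OF matrix_vector_mul(2)[OF linear_plane_proj[OF sub(1)]], of y]
      fun_cong[OF matrix_vector_mul(2)[OF linear_plane_proj[OF sub(2)]], of y] eq by simp
  then show "P = Q"
    using plane_eq_fixpoints[OF sub(1)] plane_eq_fixpoints[OF sub(2)] by simp
qed

lemma space_grassmannian: "space grassmannian = {P. subspace P \<and> dim P = 2}"
  by (simp add: grassmannian_def)

text \<open>The measurable sets are preimages of Borel sets of matrices. A plane is the fixed-point
  set of its projection, so the coding by matrices is injective and the preimage of one matrix is
  one plane.\<close>

lemma singleton_grassmannian:
  assumes "P \<in> space grassmannian"
  shows "{P} \<in> sets grassmannian"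
proof -
  let ?f = "\<lambda>P. matrix (plane_proj P)"
  let ?X = "{P. subspace P \<and> dim P = 2}"
  have "?f -` {?f P} \<inter> ?X \<in> sets grassmannian"
    unfolding grassmannian_def by (rule in_vimage_algebra) simp
  moreover have "?f -` {?f P} \<inter> ?X = {P}"
    using assms inj_on_plane_matrix by (auto simp: space_grassmannian inj_on_def)
  ultimately show ?thesis by simp
qed

section \<open>Measures of faces and of their sum\<close>

lemma sets_face_varifold: "sets (face_varifold F) = sets (borel \<Otimes>\<^sub>M grassmannian)"
  unfolding face_varifold_def by (rule sets_pair_measure_cong) auto

lemma emeasure_face_varifold:
  assumes "F \<in> sets borel" "A \<in> sets borel" "S \<in> sets grassmannian"
    and P: "face_direction F \<in> space grassmannian"
  shows "emeasure (face_varifold F) (A \<times> S) = hausdorff2_outer (F \<inter> A) * indicator S (face_direction F)"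
proof -
  \<comment> \<open>The product formula on rectangles asks for a sigma-finite second factor; here it
    is a point mass.\<close>
  interpret prob_space "return grassmannian (face_direction F)" by (rule prob_space_return[OF P])
  have "emeasure (density hausdorff2 (indicator F)) A = (\<integral>\<^sup>+y. indicator F y * indicator A y \<partial>hausdorff2)"
    using assms by (intro emeasure_density) auto
  also have "\<dots> = (\<integral>\<^sup>+y. indicator (F \<inter> A) y \<partial>hausdorff2)"
    by (simp add: indicator_inter_arith)
  also have "\<dots> = hausdorff2_outer (F \<inter> A)"
    using assms by (simp add: emeasure_hausdorff2)
  finally show ?thesis
    using assms unfolding face_varifold_def by (subst emeasure_pair_measure_Times) auto
qed

lemma sets_surface_varifold: "sets (surface_varifold \<F>) = sets (borel \<Otimes>\<^sub>M grassmannian)"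
  unfolding surface_varifold_def by (rule sets.sets_measure_of_eq)

lemma space_surface_varifold: "space (surface_varifold \<F>) = UNIV \<times> space grassmannian"
  using sets_eq_imp_space_eq[OF sets_surface_varifold] by (simp add: space_pair_measure)

text \<open>Countable additivity follows by interchanging the series with the integral over the
  faces, so \<open>measure_of\<close> takes the intended values.\<close>

lemma emeasure_surface_varifold:
  assumes "B \<in> sets (borel \<Otimes>\<^sub>M grassmannian)"
  shows "emeasure (surface_varifold \<F>) B = (\<integral>\<^sup>+F. emeasure (face_varifold F) B \<partial>count_space \<F>)"
  unfolding surface_varifold_def
proof (rule emeasure_measure_of_sigma)
  let ?W = "borel \<Otimes>\<^sub>M grassmannian :: ((real^3) \<times> (real^3) set) measure"
  let ?\<mu> = "\<lambda>B. \<integral>\<^sup>+F. emeasure (face_varifold F) B \<partial>count_space \<F>"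
  show "sigma_algebra (space ?W) (sets ?W)" by (rule sets.sigma_algebra_axioms)
  show "positive (sets ?W) ?\<mu>" by (simp add: positive_def)
  show "countably_additive (sets ?W) ?\<mu>"
  proof (rule countably_additiveI)
    fix A :: "nat \<Rightarrow> ((real^3) \<times> (real^3) set) set" assume A: "range A \<subseteq> sets ?W" "disjoint_family A"
    have "(\<Sum>i. ?\<mu> (A i)) = (\<integral>\<^sup>+F. (\<Sum>i. emeasure (face_varifold F) (A i)) \<partial>count_space \<F>)"
      by (rule nn_integral_suminf[symmetric]) simp
    also have "\<dots> = ?\<mu> (\<Union>i. A i)"
      using A by (intro nn_integral_cong suminf_emeasure) (simp_all only: sets_face_varifold)
    finally show "(\<Sum>i. ?\<mu> (A i)) = ?\<mu> (\<Union>i. A i)" .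
  qed
qed (rule assms)

text \<open>By Lindelof, countably many of the balls given by local finiteness cover the surface,
  and each meets finitely many faces. Countability makes the union of the sets carrying the varifold
  measurable.\<close>

lemma countable_faces:
  assumes "surface_triangulation \<F> \<E> \<V>"
  shows "countable \<F>"
proof -
  let ?M = "polyhedral_surface \<F>"
  have "\<forall>y\<in>?M. \<exists>r. 0 < r \<and> finite {F \<in> \<F>. F \<inter> ball y r \<noteq> {}}"
    using assms by (simp add: surface_triangulation_def)
  from bchoice[OF this] obtain r where
    r: "\<And>y. y \<in> ?M \<Longrightarrow> 0 < r y" "\<And>y. y \<in> ?M \<Longrightarrow> finite {F \<in> \<F>. F \<inter> ball y (r y) \<noteq> {}}"
    by blast
  obtain \<B> where \<B>: "\<B> \<subseteq> (\<lambda>y. ball y (r y)) ` ?M" "countable \<B>" "\<Union>\<B> = (\<Union>y\<in>?M. ball y (r y))"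
    by (rule Lindelof[of "(\<lambda>y. ball y (r y)) ` ?M"]) auto
  have "\<F> \<subseteq> (\<Union>B\<in>\<B>. {F \<in> \<F>. F \<inter> B \<noteq> {}})"
  proof
    fix F assume F: "F \<in> \<F>"
    have "2 simplex F" using assms F by (simp add: surface_triangulation_def)
    then have "F \<noteq> {}" by (auto simp: simplex_def)
    then obtain y where y: "y \<in> F" by auto
    then have "y \<in> ?M" using F by (auto simp: polyhedral_surface_def)
    then have "y \<in> \<Union>\<B>" unfolding \<B>(3) using r(1) by (intro UN_I[of y]) auto
    then show "F \<in> (\<Union>B\<in>\<B>. {F \<in> \<F>. F \<inter> B \<noteq> {}})" using F y by blast
  qed
  moreover have "countable {F \<in> \<F>. F \<inter> B \<noteq> {}}" if "B \<in> \<B>" for B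
    using that \<B>(1) r(2) by (auto intro: countable_finite)
  ultimately show ?thesis using \<B>(2) by (meson countable_UN countable_subset)
qed

lemma face_is_triangle:
  assumes "surface_triangulation \<F> \<E> \<V>" "F \<in> \<F>"
  obtains x v w where "is_triangle x v w F"
proof -
  have F: "2 simplex F" using assms by (simp add: surface_triangulation_def)
  obtain C where C: "\<not> affine_dependent C" "int (card C) = 2 + 1" "F = convex hull C"
    using F by (auto simp: simplex_def)
  then obtain x where "x \<in> C" by fastforce
  then have "x \<in> face_vertices F"
    using C by (simp add: face_vertices_def extreme_point_of_convex_hull_affine_independent)
  then show thesis using simplex_2_vertices[OF F] that by metis
qed

text \<open>If G met the relative interior of F, the common face would be all of F, making F a face
  of G; a proper face of G would have dimension below 2.\<close>

lemma rel_interior_face_disjoint: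
  assumes T: "surface_triangulation \<F> \<E> \<V>" and FG: "F \<in> \<F>" "G \<in> \<F>" "F \<noteq> G"
  shows "rel_interior F \<inter> G = {}"
proof (rule ccontr)
  assume "rel_interior F \<inter> G \<noteq> {}"
  then have ne: "(F \<inter> G) \<inter> rel_interior F \<noteq> {}" using rel_interior_subset by fastforce
  have face: "(F \<inter> G) face_of F" "(G \<inter> F) face_of G" and simp: "2 simplex F" "2 simplex G"
    using T FG by (auto simp: surface_triangulation_def)
  have "F \<subseteq> F \<inter> G" by (rule subset_of_face_of[OF face(1) order_refl ne])
  then have "F face_of G" using face(2) by (simp add: Int_absorb1)
  moreover have "convex G" using simp(2) by (auto simp: simplex_def)
  ultimately have "aff_dim F < aff_dim G" using FG(3) by (intro face_of_aff_dim_lt)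
  then show False using simp by (simp add: aff_dim_simplex)
qed

lemma rel_interior_borel: "rel_interior (S :: 'a::euclidean_space set) \<in> sets borel"
proof -
  obtain U where "open U" "rel_interior S = affine hull S \<inter> U"
    using openin_rel_interior[of S] by (auto simp: openin_open)
  then show ?thesis by simp
qed

text \<open>Off the relative interiors the divergence takes unspecified values, so its preimages
  differ from measurable sets by arbitrary subsets of a null set.\<close>

lemma borel_measurable_completion_AE:
  fixes f g :: "'a \<Rightarrow> 'b::topological_space"
  assumes g: "g \<in> borel_measurable M" and eq: "AE x in M. f x = g x"
  shows "f \<in> borel_measurable (completion M)"
proof (rule measurableI)
  obtain N where N: "N \<in> null_sets M" "{x \<in> space M. f x \<noteq> g x} \<subseteq> N"
    using eq by (auto elim: AE_E simp: null_sets_def)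
  fix A :: "'b set" assume A: "A \<in> sets borel"
  let ?G = "g -` A \<inter> space M - N" and ?N = "f -` A \<inter> space M \<inter> N"
  have "?N \<in> null_sets (completion M)"
    by (rule null_sets_completion_subset[OF _ null_sets_completionI[OF N(1)]]) auto
  moreover have "?G \<in> sets (completion M)"
    using measurable_sets[OF g A] N(1) by (intro sets_completionI_sets) auto
  ultimately have "?G \<union> ?N \<in> sets (completion M)" by blast
  moreover have "f -` A \<inter> space (completion M) = ?G \<union> ?N" using N(2) by auto
  ultimately show "f -` A \<inter> space (completion M) \<in> sets (completion M)" by simp
qed simp

lemma integral_surface_varifold:
  fixes f :: "(real^3) \<times> (real^3) set \<Rightarrow> real"
  assumes T: "surface_triangulation \<F> \<E> \<V>" and S: "finite S" "S \<subseteq> \<F>"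
    and f: "\<And>F y. F \<in> \<F> \<Longrightarrow> y \<in> rel_interior F \<Longrightarrow> f (y, face_direction F) = c F"
    and c: "\<And>F. F \<in> \<F> - S \<Longrightarrow> c F = 0"
  shows "(\<integral>z. f z \<partial>completion (surface_varifold \<F>)) = (\<Sum>F\<in>S. c F * enn2real (hausdorff2_outer F))"
proof -
  let ?V = "surface_varifold \<F>"
  let ?W = "borel \<Otimes>\<^sub>M grassmannian :: ((real^3) \<times> (real^3) set) measure"
  \<comment> \<open>These sets are pairwise disjoint, and each carries exactly the mass of its own
    face: the other faces avoid the relative interior, and its own boundary is null.\<close>
  define R where "R F = rel_interior F \<times> {face_direction F}" for F :: "(real^3) set"
  have faces: "F \<in> sets borel" "face_direction F \<in> space grassmannian"
      "hausdorff2_outer F < \<infinity>" "hausdorff2_outer (F - rel_interior F) = 0" if F: "F \<in> \<F>" for F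
  proof -
    obtain x v w where t: "is_triangle x v w F" by (rule face_is_triangle[OF T F])
    show "F \<in> sets borel" using compact_triangle[OF t] by (rule borel_compact)
    show "face_direction F \<in> space grassmannian"
      by (simp add: space_grassmannian subspace_face_direction dim_face_direction[OF t])
    show "hausdorff2_outer F < \<infinity>" by (simp add: hausdorff2_triangle[OF t])
    show "hausdorff2_outer (F - rel_interior F) = 0" by (rule hausdorff2_triangle_frontier[OF t])
  qed
  have R: "R F \<in> sets ?W" if "F \<in> \<F>" for F
    unfolding R_def using faces(2)[OF that]
    by (intro pair_measureI rel_interior_borel singleton_grassmannian)
  have R_disj: "F = G" if "F \<in> \<F>" "G \<in> \<F>" "z \<in> R F" "z \<in> R G" for F G z
  proof (rule ccontr)
    assume "F \<noteq> G"
    then have "rel_interior F \<inter> G = {}" by (rule rel_interior_face_disjoint[OF T that(1,2)])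
    then show False using that(3,4) rel_interior_subset[of G] by (auto simp: R_def)
  qed
  have emR: "emeasure ?V (R F) = hausdorff2_outer F" if F: "F \<in> \<F>" for F
  proof -
    have G: "emeasure (face_varifold G) (R F) = 0" if "G \<in> \<F> - {F}" for G
    proof -
      have "G \<inter> rel_interior F = {}" using rel_interior_face_disjoint[OF T F, of G] that by auto
      then show ?thesis
        unfolding R_def using that faces[of G] faces(2)[OF F]
        by (subst emeasure_face_varifold) (auto intro: rel_interior_borel singleton_grassmannian)
    qed
    have "hausdorff2_outer F \<le> hausdorff2_outer (rel_interior F) + hausdorff2_outer (F - rel_interior F)"
      using hausdorff2_outer_Un[of "rel_interior F" "F - rel_interior F"] rel_interior_subset[of F]
      by (simp add: Un_absorb1)
    then have "hausdorff2_outer F = hausdorff2_outer (rel_interior F)"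
      using faces(4)[OF F] hausdorff2_outer_mono[OF rel_interior_subset[of F]] by (intro antisym) auto
    moreover have "F \<inter> rel_interior F = rel_interior F" using rel_interior_subset by blast
    ultimately have FF: "emeasure (face_varifold F) (R F) = hausdorff2_outer F"
      unfolding R_def using faces(1,2)[OF F]
      by (subst emeasure_face_varifold) (auto intro: rel_interior_borel singleton_grassmannian)
    have "emeasure ?V (R F) = (\<integral>\<^sup>+G. emeasure (face_varifold G) (R F) \<partial>count_space \<F>)"
      by (rule emeasure_surface_varifold[OF R[OF F]])
    also have "\<dots> = (\<integral>\<^sup>+G. emeasure (face_varifold G) (R F) \<partial>count_space {F})"
      by (rule nn_integral_count_space_eq) (use G F in auto)
    also have "\<dots> = hausdorff2_outer F"
      by (simp add: nn_integral_count_space_finite FF)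
    finally show ?thesis .
  qed
  define N where "N = space ?W - (\<Union>F\<in>\<F>. R F)"
  have N: "N \<in> sets ?W"
    unfolding N_def using R countable_faces[OF T] by (intro sets.Diff sets.countable_UN') auto
  have "emeasure (face_varifold F) N = 0" if F: "F \<in> \<F>" for F
  proof -
    let ?\<Omega> = "space grassmannian"
    \<comment> \<open>A pair outside \<open>R F\<close> has its point off the relative interior of F
      or a direction other than that of F; each rectangle is null for the varifold of F.\<close>
    let ?A = "(UNIV - rel_interior F) \<times> ?\<Omega>" and ?B = "UNIV \<times> (?\<Omega> - {face_direction F})"
    have "UNIV - rel_interior F \<in> sets borel"
      by (intro sets.Diff rel_interior_borel) simp
    then have AB: "?A \<in> sets ?W" "?B \<in> sets ?W"
      using singleton_grassmannian[OF faces(2)[OF F]] by (auto intro!: pair_measureI)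
    have "N \<subseteq> ?A \<union> ?B" using F by (auto simp: N_def R_def space_pair_measure)
    then have "emeasure (face_varifold F) N \<le> emeasure (face_varifold F) (?A \<union> ?B)"
      using AB by (intro emeasure_mono) (auto simp: sets_face_varifold)
    also have "\<dots> \<le> emeasure (face_varifold F) ?A + emeasure (face_varifold F) ?B"
      using AB by (intro emeasure_subadditive) (auto simp: sets_face_varifold)
    also have "emeasure (face_varifold F) ?A = 0"
    proof -
      have "F \<inter> (UNIV - rel_interior F) = F - rel_interior F" by auto
      then show ?thesis
        using faces[OF F] rel_interior_borel[of F] by (subst emeasure_face_varifold) auto
    qed
    also have "emeasure (face_varifold F) ?B = 0"
      using faces[OF F] singleton_grassmannian[OF faces(2)[OF F]]
      by (subst emeasure_face_varifold) auto
    finally show ?thesis by simp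
  qed
  then have "emeasure ?V N = 0"
    using emeasure_surface_varifold[OF N, of \<F>] nn_integral_cong[of "count_space \<F>" "\<lambda>F. emeasure (face_varifold F) N" "\<lambda>_. 0"]
    by simp
  then have N0: "N \<in> null_sets ?V" using N by (simp add: null_sets_def sets_surface_varifold)
  \<comment> \<open>As c vanishes off S, this finite sum represents the integrand on all the sets
    \<open>R F\<close>, however many faces there are.\<close>
  define g where "g z = (\<Sum>F\<in>S. c F * indicator (R F) z)" for z
  have fg: "f z = g z" if z: "z \<in> R G" and G: "G \<in> \<F>" for z G
  proof -
    have "g z = (\<Sum>F\<in>S. if F = G then c G else 0)"
      unfolding g_def
    proof (rule sum.cong[OF refl])
      fix F assume "F \<in> S"
      then have "F = G" if "z \<in> R F" using R_disj[OF _ G that z] S(2) by blast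
      then show "c F * indicator (R F) z = (if F = G then c G else 0)"
        using z by (cases "F = G") (auto simp: indicator_def)
    qed
    also have "\<dots> = c G" using c[of G] G S(1) by (simp add: sum.delta)
    also have "\<dots> = f z" using f[OF G, of "fst z"] z by (cases z) (simp add: R_def)
    finally show ?thesis by simp
  qed
  have AE: "AE z in ?V. f z = g z"
  proof (rule AE_I'[OF N0])
    show "{z \<in> space ?V. f z \<noteq> g z} \<subseteq> N"
      using fg by (auto simp: N_def space_surface_varifold space_pair_measure)
  qed
  have g: "g \<in> borel_measurable ?V"
    unfolding g_def using R S(2) by (intro borel_measurable_sum borel_measurable_times borel_measurable_indicator)
      (auto simp: sets_surface_varifold)
  have "(\<integral>z. f z \<partial>completion ?V) = (\<integral>z. g z \<partial>completion ?V)"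
    using borel_measurable_completion_AE[OF g AE] measurable_completion[OF g] AE_completion[OF AE]
    by (rule integral_cong_AE)
  also have "\<dots> = (\<integral>z. g z \<partial>?V)" by (rule integral_completion[OF g])
  also have "\<dots> = (\<Sum>F\<in>S. \<integral>z. c F * indicator (R F) z \<partial>?V)"
    unfolding g_def
  proof (rule Bochner_Integration.integral_sum)
    fix F assume "F \<in> S"
    then show "integrable ?V (\<lambda>z. c F * indicator (R F) z)"
      using S(2) R emR faces(3)
      by (intro integrable_mult_right integrable_real_indicator) (auto simp: sets_surface_varifold)
  qed
  also have "\<dots> = (\<Sum>F\<in>S. c F * enn2real (hausdorff2_outer F))"
  proof (rule sum.cong[OF refl])
    fix F assume "F \<in> S"
    then have F: "F \<in> \<F>" using S(2) by auto
    have "R F \<inter> space ?V = R F"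
      using sets.sets_into_space[OF R[OF F]] by (auto simp: space_surface_varifold space_pair_measure)
    then show "(\<integral>z. c F * indicator (R F) z \<partial>?V) = c F * enn2real (hausdorff2_outer F)"
      by (simp add: measure_def emR[OF F])
  qed
  finally show ?thesis .
qed

section \<open>The Cotangent Formula\<close>

text \<open>The vector \<open>a\<close> supplied by the definition of a nodal function need not be
  parallel to the face. The tangential gradient is found instead from the values at the vertices: 1,
  0, 0 if x is one of them, otherwise all 0, which gives gradient 0.\<close>

lemma nodal_function_gradient:
  assumes T: "surface_triangulation \<F> \<E> \<V>" and \<phi>: "nodal_function \<F> \<V> x \<phi>" and F: "F \<in> \<F>"
  shows "\<exists>t\<in>face_direction F. (\<forall>y\<in>F. \<forall>z\<in>F. \<phi> z = \<phi> y + t \<bullet> (z - y)) \<and>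
    (x \<notin> face_vertices F \<longrightarrow> t = 0) \<and>
    (x \<in> face_vertices F \<longrightarrow> enn2real (hausdorff2_outer F) *\<^sub>R t =
      - (1/2) *\<^sub>R (\<Sum>v\<in>face_vertices F - {x}. cot (opposite_angle F x v) *\<^sub>R (v - x)))"
proof -
  have \<V>: "\<V> = (\<Union>F\<in>\<F>. face_vertices F)" and simp: "2 simplex F"
    using T F unfolding surface_triangulation_def by blast+
  obtain a b where ab: "\<And>y. y \<in> F \<Longrightarrow> \<phi> y = a \<bullet> y + b"
    using \<phi> F unfolding nodal_function_def by blast
  have \<phi>x: "\<phi> x = 1" using \<phi> by (simp add: nodal_function_def)
  have zero: "\<phi> v = 0" if "v \<in> face_vertices F" "v \<noteq> x" for v
    using \<phi> that F unfolding nodal_function_def \<V> by blast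
  have affine: "\<phi> z = \<phi> y + t \<bullet> (z - y)"
    if tri: "is_triangle u v w F" and yz: "y \<in> F" "z \<in> F"
      and t: "t \<bullet> (v - u) = \<phi> v - \<phi> u" "t \<bullet> (w - u) = \<phi> w - \<phi> u" for t u v w y z
  proof -
    have uvw: "u \<in> F" "v \<in> F" "w \<in> F" using triangle_subset[OF tri] by auto
    \<comment> \<open>On the edge vectors t reproduces the increments of \<phi>, as \<open>a\<close>
      does; so \<open>a - t\<close> is orthogonal to the face and does not affect differences within
      it.\<close>
    then have d: "(a - t) \<bullet> (v - u) = 0" "(a - t) \<bullet> (w - u) = 0"
      using t ab by (simp_all add: inner_diff_left inner_diff_right)
    obtain r s where y: "y = u + r *\<^sub>R (v - u) + s *\<^sub>R (w - u)" by (rule triangle_points[OF tri yz(1)])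
    obtain r' s' where z: "z = u + r' *\<^sub>R (v - u) + s' *\<^sub>R (w - u)" by (rule triangle_points[OF tri yz(2)])
    have "(a - t) \<bullet> (z - y) = (a - t) \<bullet> ((r' - r) *\<^sub>R (v - u) + (s' - s) *\<^sub>R (w - u))"
      unfolding y z by (simp add: algebra_simps)
    also have "\<dots> = 0" unfolding inner_add_right inner_scaleR_right d by simp
    finally show ?thesis using ab yz by (simp add: inner_diff_left inner_diff_right)
  qed
  show ?thesis
  proof (cases "x \<in> face_vertices F")
    case True
    then obtain v w where tri: "is_triangle x v w F" by (rule simplex_2_vertices[OF simp])
    then have fv: "face_vertices F = {x, v, w}" and ne: "x \<noteq> v" "x \<noteq> w" "v \<noteq> w"
      by (auto simp: face_vertices_triangle is_triangle_def)
    let ?t = "nodal_gradient (v - x) (w - x)"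
    have G: "0 < gram (v - x) (w - x)" by (rule triangle_gram_pos[OF tri])
    have "\<phi> v = 0" "\<phi> w = 0" using zero fv ne by auto
    then have "\<phi> z = \<phi> y + ?t \<bullet> (z - y)" if "y \<in> F" "z \<in> F" for y z
      using affine[OF tri that] nodal_gradient_inner[OF G] \<phi>x by simp
    moreover have "?t \<in> face_direction F"
      unfolding face_direction_triangle[OF tri] nodal_gradient_def
      by (intro span_scale span_neg span_add span_base) auto
    moreover have "enn2real (hausdorff2_outer F) *\<^sub>R ?t =
      - (1/2) *\<^sub>R (\<Sum>v\<in>face_vertices F - {x}. cot (opposite_angle F x v) *\<^sub>R (v - x))"
    proof -
      have area: "enn2real (hausdorff2_outer F) = sqrt (gram (v - x) (w - x)) / 2"
        using G by (simp add: hausdorff2_triangle[OF tri])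
      have "face_vertices F - {x} = {v, w}" using fv ne by auto
      then have sum: "(\<Sum>v\<in>face_vertices F - {x}. cot (opposite_angle F x v) *\<^sub>R (v - x)) =
          cot (opposite_angle F x v) *\<^sub>R (v - x) + cot (opposite_angle F x w) *\<^sub>R (w - x)"
        using ne by simp
      show ?thesis unfolding area sum by (rule area_nodal_gradient[OF tri])
    qed
    ultimately show ?thesis using True by blast
  next
    case False
    obtain u v w where tri: "is_triangle u v w F" by (rule face_is_triangle[OF T F])
    have "\<phi> u = 0" "\<phi> v = 0" "\<phi> w = 0"
      using zero False unfolding face_vertices_triangle[OF tri] by auto
    then have "\<phi> z = \<phi> y + 0 \<bullet> (z - y)" if "y \<in> F" "z \<in> F" for y z
      using affine[OF tri that, of 0] by simp
    then show ?thesis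
      using False subspace_0[OF subspace_face_direction] by blast
  qed
qed

text \<open>Only the j-th component of the field is nonzero. Its gradient is t, and the divergence
  picks the j-th coordinate.\<close>

lemma tangential_divergence_affine:
  assumes t: "t \<in> face_direction F" and y: "y \<in> rel_interior F"
    and g: "\<And>z. z \<in> F \<Longrightarrow> g z = g y + t \<bullet> (z - y)"
  shows "tangential_divergence (face_direction F) (\<lambda>z. g z *\<^sub>R axis j 1) y = t $ j"
proof -
  have "tangential_gradient (face_direction F) (\<lambda>z. (g z *\<^sub>R axis j 1) $ i) y = (axis j 1 $ i) *\<^sub>R t" for i
  proof (rule tangential_gradient_affine[OF _ y])
    show "(axis j 1 $ i) *\<^sub>R t \<in> face_direction F"
      by (rule subspace_scale[OF subspace_face_direction t])
    show "(g z *\<^sub>R axis j 1) $ i = (g y *\<^sub>R axis j 1) $ i + (axis j 1 $ i) *\<^sub>R t \<bullet> (z - y)" if "z \<in> F" for z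
      by (subst g[OF that]) (simp add: algebra_simps)
  qed
  then have "tangential_divergence (face_direction F) (\<lambda>z. g z *\<^sub>R axis j 1) y =
      (\<Sum>i\<in>UNIV. axis j 1 $ i * t $ i)"
    by (simp add: tangential_divergence_def inner_axis)
  also have "\<dots> = (\<Sum>i\<in>UNIV. if i = j then t $ i else 0)"
    by (rule sum.cong) (auto simp: axis_def)
  finally show ?thesis by simp
qed

theorem proposition7p1:
  fixes \<F> :: "(real^3) set set" and \<E> :: "((real^3) \<times> (real^3)) set" and \<V> :: "(real^3) set"
    and x :: "real^3" and \<phi> \<phi>_hat :: "real^3 \<Rightarrow> real" and \<alpha> \<beta> :: "real^3 \<Rightarrow> real"
  assumes "surface_triangulation \<F> \<E> \<V>"
    and "x \<in> \<V>"
    and "nodal_function \<F> \<V> x \<phi>"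
    and "\<exists>C. C-lipschitz_on UNIV \<phi>_hat"
    and "\<forall>y. 0 \<le> \<phi>_hat y"
    and "\<forall>y\<in>polyhedral_surface \<F>. \<phi>_hat y = \<phi> y"
    and "\<forall>v\<in>neighbours \<E> x. edge_opposite_angles \<F> x v (\<alpha> v) (\<beta> v)"
  shows "first_variation_scalar (surface_varifold \<F>) \<phi>_hat = - cotangent_curvature \<F> \<E> \<V> \<phi> \<and>
    - cotangent_curvature \<F> \<E> \<V> \<phi> =
      - (1/2) *\<^sub>R (\<Sum>v\<in>neighbours \<E> x. (cot (\<alpha> v) + cot (\<beta> v)) *\<^sub>R (v - x))"
proof
  note T = assms(1)
  \<comment> \<open>The star of x, the only faces on which the nodal function has nonzero
    gradient.\<close>
  define S where "S = {F \<in> \<F>. x \<in> face_vertices F}"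
  have \<V>: "\<V> = (\<Union>F\<in>\<F>. face_vertices F)" and \<E>: "\<E> = {(v, w). v \<noteq> w \<and> edge_faces \<F> v w \<noteq> {}}"
    using T unfolding surface_triangulation_def by blast+
  have sub: "face_vertices F \<subseteq> F" "finite (face_vertices F)" if F: "F \<in> \<F>" for F
  proof -
    obtain u v w where tri: "is_triangle u v w F" by (rule face_is_triangle[OF T F])
    show "face_vertices F \<subseteq> F" "finite (face_vertices F)"
      unfolding face_vertices_triangle[OF tri] using triangle_subset[OF tri] by auto
  qed
  have S_fin: "finite S"
  proof -
    have "x \<in> polyhedral_surface \<F>"
      using assms(2) sub(1) by (auto simp: \<V> polyhedral_surface_def)
    then obtain r where r: "0 < r" "finite {F \<in> \<F>. F \<inter> ball x r \<noteq> {}}"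
      using T unfolding surface_triangulation_def by blast
    have "S \<subseteq> {F \<in> \<F>. F \<inter> ball x r \<noteq> {}}"
    proof
      fix F assume "F \<in> S"
      then have "F \<in> \<F>" "x \<in> F \<inter> ball x r" using sub(1) r(1) by (auto simp: S_def)
      then show "F \<in> {F \<in> \<F>. F \<inter> ball x r \<noteq> {}}" by blast
    qed
    then show ?thesis using r(2) by (rule finite_subset)
  qed
  let ?P = "\<lambda>F t. t \<in> face_direction F \<and> (\<forall>y\<in>F. \<forall>z\<in>F. \<phi> z = \<phi> y + t \<bullet> (z - y)) \<and>
    (x \<notin> face_vertices F \<longrightarrow> t = 0) \<and>
    (x \<in> face_vertices F \<longrightarrow> enn2real (hausdorff2_outer F) *\<^sub>R t =
      - (1/2) *\<^sub>R (\<Sum>v\<in>face_vertices F - {x}. cot (opposite_angle F x v) *\<^sub>R (v - x)))"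
  have "\<forall>F\<in>\<F>. \<exists>t. ?P F t"
    using nodal_function_gradient[OF T assms(3)] unfolding Bex_def by blast
  from bchoice[OF this] obtain t where t: "\<And>F. F \<in> \<F> \<Longrightarrow> ?P F (t F)" by blast
  have t_affine: "\<phi> z = \<phi> y + t F \<bullet> (z - y)" if "F \<in> \<F>" "y \<in> F" "z \<in> F" for F y z
    using t that by blast
  have t_zero: "t F = 0" if "F \<in> \<F>" "x \<notin> face_vertices F" for F
    using t that by blast
  have t_area: "enn2real (hausdorff2_outer F) *\<^sub>R t F =
      - (1/2) *\<^sub>R (\<Sum>v\<in>face_vertices F - {x}. cot (opposite_angle F x v) *\<^sub>R (v - x))"
    if "F \<in> S" for F
    using t that unfolding S_def by blast
  let ?N = "neighbours \<E> x"
  let ?c = "\<lambda>F v. cot (opposite_angle F x v) *\<^sub>R (v - x)"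
  have N: "?N = (\<Union>F\<in>S. face_vertices F) - {x}"
    by (auto simp: neighbours_def \<E> edge_faces_def S_def)
  then have N_fin: "finite ?N" using S_fin sub(2) by (auto simp: S_def)
  have div: "tangential_divergence (face_direction F) (\<lambda>z. \<phi>_hat z *\<^sub>R axis j 1) y = t F $ j"
    if F: "F \<in> \<F>" and y: "y \<in> rel_interior F" for F y j
  proof (rule tangential_divergence_affine[OF _ y])
    show "t F \<in> face_direction F" using t[OF F] by blast
    have hat: "\<phi>_hat z = \<phi> z" if "z \<in> F" for z
      using assms(6) that F unfolding polyhedral_surface_def by blast
    have "y \<in> F" using y rel_interior_subset by blast
    show "\<phi>_hat z = \<phi>_hat y + t F \<bullet> (z - y)" if "z \<in> F" for z
      unfolding hat[OF that] hat[OF \<open>y \<in> F\<close>] by (rule t_affine[OF F \<open>y \<in> F\<close> that])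
  qed
  have "first_variation_scalar (surface_varifold \<F>) \<phi>_hat $ j =
      (\<Sum>F\<in>S. t F $ j * enn2real (hausdorff2_outer F))" for j
    unfolding first_variation_scalar_def first_variation_def vec_lambda_beta
  proof (rule integral_surface_varifold[OF T S_fin])
    show "S \<subseteq> \<F>" by (auto simp: S_def)
    show "t F $ j = 0" if "F \<in> \<F> - S" for F
      using t_zero[of F] that by (simp add: S_def)
  qed (simp add: div)
  then have "first_variation_scalar (surface_varifold \<F>) \<phi>_hat =
      (\<Sum>F\<in>S. enn2real (hausdorff2_outer F) *\<^sub>R t F)"
    by (simp add: vec_eq_iff mult.commute)
  also have "\<dots> = (\<Sum>F\<in>S. - (1/2) *\<^sub>R (\<Sum>v\<in>face_vertices F - {x}. ?c F v))"
    by (intro sum.cong refl t_area)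
  also have "\<dots> = - (1/2) *\<^sub>R (\<Sum>F\<in>S. \<Sum>v\<in>face_vertices F - {x}. ?c F v)"
    by (rule scaleR_sum_right[symmetric])
  \<comment> \<open>Vertices other than x of a face in the star are neighbours of x. With the inner
    range written as a condition on neighbours, the two finite sums can be interchanged.\<close>
  also have "(\<Sum>F\<in>S. \<Sum>v\<in>face_vertices F - {x}. ?c F v) =
      (\<Sum>F\<in>S. \<Sum>v | v \<in> ?N \<and> v \<in> face_vertices F. ?c F v)"
    unfolding N by (intro sum.cong refl) auto
  also have "\<dots> = (\<Sum>v\<in>?N. \<Sum>F | F \<in> S \<and> v \<in> face_vertices F. ?c F v)"
    by (rule sum.swap_restrict[OF S_fin N_fin])
  also have "\<dots> = (\<Sum>v\<in>?N. (\<Sum>F\<in>edge_faces \<F> x v. cot (opposite_angle F x v)) *\<^sub>R (v - x))"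
    unfolding scaleR_sum_left by (intro sum.cong refl) (auto simp: edge_faces_def S_def)
  finally have variation: "first_variation_scalar (surface_varifold \<F>) \<phi>_hat =
      - (1/2) *\<^sub>R (\<Sum>v\<in>?N. (\<Sum>F\<in>edge_faces \<F> x v. cot (opposite_angle F x v)) *\<^sub>R (v - x))" .
  \<comment> \<open>A function with value 1 at x and 0 at all other vertices cannot be nodal at
    another vertex.\<close>
  have "(THE x. x \<in> \<V> \<and> nodal_function \<F> \<V> x \<phi>) = x"
  proof (rule the_equality)
    fix y assume "y \<in> \<V> \<and> nodal_function \<F> \<V> y \<phi>"
    then show "y = x" using assms(3) unfolding nodal_function_def by force
  qed (use assms in blast)
  then have curvature: "- cotangent_curvature \<F> \<E> \<V> \<phi> =
      - (1/2) *\<^sub>R (\<Sum>v\<in>?N. (\<Sum>F\<in>edge_faces \<F> x v. cot (opposite_angle F x v)) *\<^sub>R (v - x))"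
    by (simp add: cotangent_curvature_def)
  show "first_variation_scalar (surface_varifold \<F>) \<phi>_hat = - cotangent_curvature \<F> \<E> \<V> \<phi>"
    unfolding variation curvature ..
  have angles: "(\<Sum>F\<in>edge_faces \<F> x v. cot (opposite_angle F x v)) = cot (\<alpha> v) + cot (\<beta> v)"
    if "v \<in> ?N" for v
  proof -
    have "edge_opposite_angles \<F> x v (\<alpha> v) (\<beta> v)" using assms(7) that by (rule bspec)
    then obtain F G where FG: "F \<noteq> G" "edge_faces \<F> x v = {F, G}"
        "\<alpha> v = opposite_angle F x v" "\<beta> v = opposite_angle G x v"
      unfolding edge_opposite_angles_def by (elim exE conjE)
    then show ?thesis unfolding FG(2-4) by simp
  qed
  have "(\<Sum>v\<in>?N. (\<Sum>F\<in>edge_faces \<F> x v. cot (opposite_angle F x v)) *\<^sub>R (v - x)) =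
      (\<Sum>v\<in>?N. (cot (\<alpha> v) + cot (\<beta> v)) *\<^sub>R (v - x))"
    by (rule sum.cong[OF refl]) (simp only: angles)
  then show "- cotangent_curvature \<F> \<E> \<V> \<phi> =
      - (1/2) *\<^sub>R (\<Sum>v\<in>?N. (cot (\<alpha> v) + cot (\<beta> v)) *\<^sub>R (v - x))"
    unfolding curvature by (rule arg_cong)
qed

end
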